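(* Let $\mathcal{U}$ be a free ultrafilter on $\mathbb{N}$, let ${}^*\mathbb{R}=\mathbb{R}^{\mathbb{N}}/\!\sim_{\mathcal{U}}$ be the corresponding field of non-standard numbers, let $\rho\in{}^*\mathbb{R}$ be a positive infinitesimal, and let ${}^\rho\mathbb{R}$ be Robinson's field of asymptotic numbers determined by $\rho$. Put ${}^*\mathbb{C}={}^*\mathbb{R}(i)$ and ${}^\rho\mathbb{C}={}^\rho\mathbb{R}(i)$. Then there are field isomorphisms $$\mathbb{C}\cong{}^*\mathbb{C}\cong{}^\rho\mathbb{C}.$$
   Context: Here $(a_n)\sim_{\mathcal{U}}(b_n)$ for sequences in $\mathbb{R}^{\mathbb{N}}$ means $\{n\in\mathbb{N}: a_n=b_n\}\in\mathcal{U}$; ${}^*\mathbb{R}$ is the resulting ultrapower of $\mathbb{R}$, an ordered field containing $\mathbb{R}$ via constant sequences. An element $x\in{}^*\mathbb{R}$ is infinitesimal if $|x|<1/n$ for all $n\in\mathbb{N}=\{1,2,3,\dots\}$. Robinson's field of asymptotic numbers is the quotient ${}^\rho\mathbb{R}=\mathcal{M}_\rho/\mathcal{N}_\rho$, where $$\mathcal{M}_\rho=\{x\in{}^*\mathbb{R}: |x|\le\rho^{-n}\text{ for some }n\in\mathbb{N}\},\qquad \mathcal{N}_\rho=\{x\in{}^*\mathbb{R}: |x|<\rho^{n}\text{ for all }n\in\mathbb{N}\}.$$ It is known that ${}^*\mathbb{R}$ and ${}^\rho\mathbb{R}$ are real closed fields. For a real closed field $\mathcal{R}$, $\mathcal{R}(i)$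 denotes the field obtained by adjoining a root $i$ of $x^2+1$. The isomorphisms are isomorphisms of (abstract) fields, with no topology involved. *)

theory Defs
  imports
    Complex_Main
    "HOL-Algebra.Polynomial_Divisibility"
    "HOL-Algebra.Algebraic_Closure_Type"
begin

section \<open>Free ultrafilters\<close>

text \<open>
  A family of subsets of \<open>\<nat>\<close> closed under supersets and finite intersections is represented by a
  library filter \<open>U :: nat filter\<close>; a set \<open>A\<close> belongs to it iff
  \<open>eventually (\<lambda>n. n \<in> A) U\<close>. Library filters may be improper, hence the condition \<open>U \<noteq> bot\<close>
  (the empty set is not a member). Free means that the members have empty intersection.
\<close>

definition free_ultrafilter :: "nat filter \<Rightarrow> bool" where
  "free_ultrafilter U \<longleftrightarrow>
     U \<noteq> bot \<and>
     (\<forall>P. eventually P U \<or> eventually (\<lambda>n. \<not> P n) U) \<and>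
     (\<forall>n. \<exists>P. eventually P U \<and> \<not> P n)"

section \<open>The ultrapower of the reals\<close>

type_synonym star_real = "(nat \<Rightarrow> real) set"

definition star_rel :: "nat filter \<Rightarrow> ((nat \<Rightarrow> real) \<times> (nat \<Rightarrow> real)) set" where
  "star_rel U = {(a, b). eventually (\<lambda>n. a n = b n) U}"

definition star_class :: "nat filter \<Rightarrow> (nat \<Rightarrow> real) \<Rightarrow> star_real" where
  "star_class U a = star_rel U `` {a}"

definition star_of :: "nat filter \<Rightarrow> real \<Rightarrow> star_real" where
  "star_of U r = star_class U (\<lambda>n. r)"

text \<open>
  The operations are pointwise on representatives; the union of the resulting classes over all
  representatives is the usual way to write a function on a quotient, since they all coincide.
\<close>

definition star_R :: "nat filter \<Rightarrow> star_real ring" where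
  "star_R U =
     \<lparr>carrier = UNIV // star_rel U,
      monoid.mult = (\<lambda>x y. \<Union>a\<in>x. \<Union>b\<in>y. star_class U (\<lambda>n. a n * b n)),
      one = star_of U 1,
      ring.zero = star_of U 0,
      add = (\<lambda>x y. \<Union>a\<in>x. \<Union>b\<in>y. star_class U (\<lambda>n. a n + b n))\<rparr>"

definition star_le :: "nat filter \<Rightarrow> star_real \<Rightarrow> star_real \<Rightarrow> bool" where
  "star_le U x y \<longleftrightarrow> (\<exists>a\<in>x. \<exists>b\<in>y. eventually (\<lambda>n. a n \<le> b n) U)"

definition star_less :: "nat filter \<Rightarrow> star_real \<Rightarrow> star_real \<Rightarrow> bool" where
  "star_less U x y \<longleftrightarrow> star_le U x y \<and> x \<noteq> y"

definition star_abs :: "nat filter \<Rightarrow> star_real \<Rightarrow> star_real" where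
  "star_abs U x = (if star_le U \<zero>\<^bsub>star_R U\<^esub> x then x else \<ominus>\<^bsub>star_R U\<^esub> x)"

definition star_infinitesimal :: "nat filter \<Rightarrow> star_real \<Rightarrow> bool" where
  "star_infinitesimal U x \<longleftrightarrow>
     x \<in> carrier (star_R U) \<and>
     (\<forall>n::nat. n \<ge> 1 \<longrightarrow> star_less U (star_abs U x) (star_of U (1 / real n)))"

section \<open>Robinson's asymptotic numbers\<close>

definition moderate :: "nat filter \<Rightarrow> star_real \<Rightarrow> star_real set" where
  "moderate U \<rho> =
     {x \<in> carrier (star_R U).
        \<exists>n::nat. n \<ge> 1 \<and>
          star_le U (star_abs U x) (inv\<^bsub>star_R U\<^esub> (\<rho> [^]\<^bsub>star_R U\<^esub> n))}"

definition negligible :: "nat filter \<Rightarrow> star_real \<Rightarrow> star_real set" where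
  "negligible U \<rho> =
     {x \<in> carrier (star_R U).
        \<forall>n::nat. n \<ge> 1 \<longrightarrow> star_less U (star_abs U x) (\<rho> [^]\<^bsub>star_R U\<^esub> n)}"

definition rho_R :: "nat filter \<Rightarrow> star_real \<Rightarrow> star_real set ring" where
  "rho_R U \<rho> = (star_R U)\<lparr>carrier := moderate U \<rho>\<rparr> Quot (negligible U \<rho>)"

section \<open>Adjoining a square root of minus one\<close>

text \<open>
  \<open>R(i)\<close> is the rupture ring \<open>R[X] / (X\<^sup>2 + 1)\<close>. Polynomials in \<open>HOL-Algebra.Polynomials\<close> are
  coefficient lists with the leading coefficient first.
\<close>

definition adjoin_i :: "'a ring \<Rightarrow> 'a list set ring" where
  "adjoin_i R = Rupt\<^bsub>R\<^esub> (carrier R) [\<one>\<^bsub>R\<^esub>, \<zero>\<^bsub>R\<^esub>, \<one>\<^bsub>R\<^esub>]"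

definition star_C :: "nat filter \<Rightarrow> star_real list set ring" where
  "star_C U = adjoin_i (star_R U)"

definition rho_C :: "nat filter \<Rightarrow> star_real \<Rightarrow> star_real set list set ring" where
  "rho_C U \<rho> = adjoin_i (rho_R U \<rho>)"

end

theory Submission
  imports
    Defs
    "HOL-Algebra.Generated_Fields"
    "HOL-Library.Equipollence"
    "HOL-Analysis.Abstract_Topology_2"
    "HOL-Analysis.Continuum_Not_Denumerable"
begin

text \<open>
  All three fields are algebraically closed, of characteristic zero and of the cardinality of the
  continuum, and by a theorem of Steinitz an algebraically closed field of uncountable cardinality
  is determined up to isomorphism by its characteristic and its cardinality.

  Steinitz's theorem. By Zorn's lemma there is a maximal algebraically independent set \<open>B\<close>, and
  by the exchange lemma (\<open>acl_exchange\<close>) the whole field is algebraic over the subfield generated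
  by \<open>B\<close>. Passing to the algebraic closure does not increase an infinite cardinality
  (\<open>acl_lepoll\<close>), hence \<open>B\<close> is equipotent to the field if that is uncountable, and transcendence bases of
  two equipotent uncountable fields are in bijection. The bijection generates a partial isomorphism between subrings
  (\<open>partial_iso_independent\<close>), which by Zorn's lemma extends to a maximal one; a maximal one has a
  field as its domain, and it could be extended by any element that is algebraic over this domain
  but outside it (\<open>partial_iso_extend_algebraic\<close>). So its domain is everything, and by symmetry
  so is its range.

  The fields \<open>*C\<close> and \<open>\<rho>C\<close>. Both \<open>*R\<close> and \<open>\<rho>R\<close> are quotients of a ring \<open>T\<close> of real sequences
  that is solid: a sequence dominated by a member of \<open>T\<close> is a member. For \<open>*R\<close> this is the ring of
  all sequences, for \<open>\<rho>R\<close> the ring of sequences of moderate growth. The field obtained by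
  adjoining \<open>i\<close> is then the corresponding quotient of complex sequences
  (\<open>adjoin_i_complexification\<close>). A monic polynomial over it lifts to a sequence of monic complex
  polynomials, whose roots can be chosen termwise; since a root is bounded by the coefficients
  (\<open>monic_root_bound\<close>), solidity keeps the sequence of roots inside the ring. So the field
  is algebraically closed. Constant sequences embed the complex numbers, and there are no more sequences than complex numbers, so
  its cardinality is that of the continuum.
\<close>

no_notation iso_incl (infixl \<open>\<lesssim>\<close> 65)

section \<open>Algebraic closure operator and transcendence bases\<close>

lemma (in abelian_monoid) finsum_swap:
  assumes "finite A" "finite B" "\<And>i j. i \<in> A \<Longrightarrow> j \<in> B \<Longrightarrow> f i j \<in> carrier G"
  shows "(\<Oplus>i\<in>A. \<Oplus>j\<in>B. f i j) = (\<Oplus>j\<in>B. \<Oplus>i\<in>A. f i j)"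
  using assms(1,3)
proof (induction A rule: finite_induct)
  case empty
  then show ?case by simp
next
  case (insert a A)
  have closed: "(\<lambda>j. f a j) \<in> B \<rightarrow> carrier G" "(\<lambda>j. \<Oplus>i\<in>A. f i j) \<in> B \<rightarrow> carrier G"
    "(\<lambda>i. \<Oplus>j\<in>B. f i j) \<in> A \<rightarrow> carrier G" "(\<Oplus>j\<in>B. f a j) \<in> carrier G"
    using insert.prems by (auto intro!: finsum_closed)
  have "(\<Oplus>j\<in>B. \<Oplus>i\<in>insert a A. f i j) = (\<Oplus>j\<in>B. f a j \<oplus> (\<Oplus>i\<in>A. f i j))"
    using insert by (intro finsum_cong') (auto intro!: finsum_insert finsum_closed)
  also have "\<dots> = (\<Oplus>j\<in>B. f a j) \<oplus> (\<Oplus>j\<in>B. \<Oplus>i\<in>A. f i j)"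
    using closed by (intro finsum_addf) auto
  finally show ?case
    using insert closed by (simp add: finsum_insert)
qed

lemma (in ring) eval_eq_finsum:
  assumes "set p \<subseteq> carrier R" "x \<in> carrier R" "length p \<le> n"
  shows "eval p x = (\<Oplus>i\<in>{..<n}. coeff p i \<otimes> x [^] i)"
proof -
  have *: "eval p x = (\<Oplus>i\<in>{..<length p}. coeff p i \<otimes> x [^] i)"
    using assms(1)
  proof (induction p)
    case Nil
    then show ?case by simp
  next
    case (Cons a p)
    have "(\<Oplus>i\<in>{..<length p}. coeff (a # p) i \<otimes> x [^] i) = (\<Oplus>i\<in>{..<length p}. coeff p i \<otimes> x [^] i)"
      using Cons.prems assms(2) coeff_in_carrier[of p] by (intro finsum_cong') auto
    moreover have "(\<Oplus>i\<in>{..<length (a # p)}. coeff (a # p) i \<otimes> x [^] i)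
      = coeff (a # p) (length p) \<otimes> x [^] length p \<oplus> (\<Oplus>i\<in>{..<length p}. coeff (a # p) i \<otimes> x [^] i)"
      using Cons.prems assms(2) coeff_in_carrier[of "a # p"]
      by (simp add: lessThan_Suc finsum_insert del: coeff.simps)
    ultimately show ?case
      using Cons by simp
  qed
  have "(\<Oplus>i\<in>{..<n}. coeff p i \<otimes> x [^] i) = (\<Oplus>i\<in>{..<length p}. coeff p i \<otimes> x [^] i)"
    using assms coeff_in_carrier[of p] coeff_length[of p]
    by (intro add.finprod_mono_neutral_cong_right) auto
  with * show ?thesis by simp
qed

context field
begin

text \<open>
  Finite sums with coefficients indexed by exponents are the convenient form of polynomial
  relations for the exchange lemma, where a relation in two variables has to be re-sorted by powers
  of the other variable. Coefficient lists would have to be normalized after the re-sorting.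
\<close>

lemma algebraicI_finsum:
  fixes n :: nat
  assumes K: "subring K R" and x: "x \<in> carrier R" and c: "\<And>i. i < n \<Longrightarrow> c i \<in> K"
    and k: "k < n" "c k \<noteq> \<zero>" and eq: "(\<Oplus>i\<in>{..<n}. c i \<otimes> x [^] i) = \<zero>"
  shows "(algebraic over K) x"
proof (rule algebraicI)
  define q where "q = map c (rev [0..<n])"
  have q: "set q \<subseteq> K" using c by (auto simp: q_def)
  hence q': "set q \<subseteq> carrier R" using subringE(1)[OF K] by auto
  have len: "length q = n" by (simp add: q_def)
  have coeff: "coeff q i = c i" if "i < n" for i
    using coeff_nth[of i q] that by (simp add: len) (simp add: q_def rev_nth)
  show "normalize q \<in> carrier (K[X])"
    using normalize_gives_polynomial[OF q] by (simp add: univ_poly_carrier)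
  have "coeff (normalize q) k \<noteq> \<zero>"
    using coeff[of k] k normalize_coeff[of q] by metis
  thus "normalize q \<noteq> []" by auto
  have "eval (normalize q) x = eval q x" using eval_normalize q' x by blast
  also have "\<dots> = (\<Oplus>i\<in>{..<n}. coeff q i \<otimes> x [^] i)"
    using eval_eq_finsum[OF q' x] len by simp
  also have "\<dots> = (\<Oplus>i\<in>{..<n}. c i \<otimes> x [^] i)"
    using x c coeff subringE(1)[OF K] by (intro finsum_cong') auto
  finally show "eval (normalize q) x = \<zero>" using eq by simp
qed

lemma algebraicE_finsum:
  assumes K: "subring K R" and x: "x \<in> carrier R" and alg: "(algebraic over K) x"
  obtains n k c where "\<And>i. c i \<in> K" "k < n" "c k \<noteq> \<zero>" "(\<Oplus>i\<in>{..<n::nat}. c i \<otimes> x [^] i) = \<zero>"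
proof -
  obtain p where p: "p \<in> carrier (K[X])" "p \<noteq> []" "eval p x = \<zero>"
    using algebraicE[OF assms] by blast
  hence pK: "set p \<subseteq> K" "hd p \<noteq> \<zero>"
    using p(2) by (auto simp: univ_poly_def polynomial_def)
  show thesis
  proof (rule that[of "coeff p" "length p - 1" "length p"])
    have *: "coeff p i \<in> set p \<union> {\<zero>}" for i
      using coeff_img(3)[of p] by (metis rangeI)
    show "coeff p i \<in> K" for i
      using *[of i] pK(1) subringE(2)[OF K] by auto
    show "coeff p (length p - 1) \<noteq> \<zero>" using lead_coeff_simp[OF p(2)] pK(2) by simp
    show "length p - 1 < length p" using p(2) by (cases p) auto
    show "(\<Oplus>i\<in>{..<length p}. coeff p i \<otimes> x [^] i) = \<zero>"
      using eval_eq_finsum[of p x "length p"] pK subringE(1)[OF K] x p(3) by auto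
  qed
qed

lemma add_fractions:
  assumes "a \<in> carrier R" "b \<in> carrier R" "c \<in> carrier R" "d \<in> carrier R" "e \<in> carrier R" "f \<in> carrier R"
  shows "(a \<otimes> (d \<otimes> f) \<otimes> e) \<oplus> (c \<otimes> (b \<otimes> e) \<otimes> f) = (a \<otimes> d \<oplus> c \<otimes> b) \<otimes> (e \<otimes> f)"
proof -
  have "a \<otimes> (d \<otimes> f) \<otimes> e = (a \<otimes> d) \<otimes> (e \<otimes> f)" "c \<otimes> (b \<otimes> e) \<otimes> f = (c \<otimes> b) \<otimes> (e \<otimes> f)"
    using assms by (simp_all add: m_ac)
  thus ?thesis using assms by (simp add: l_distr)
qed

definition fractions :: "'a set \<Rightarrow> 'a set" where
  "fractions D = {u \<otimes> inv v |u v. u \<in> D \<and> v \<in> D \<and> v \<noteq> \<zero>}"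

lemma fractions_subfield:
  assumes D: "subring D R"
  shows "subfield (fractions D) R"
proof -
  let ?F = "{u \<otimes> inv v |u v. u \<in> D \<and> v \<in> D \<and> v \<noteq> \<zero>}"
  have "subfield ?F R"
  proof (rule subfieldI'[OF subringI])
    note DE = subringE[OF D]
    have carr: "\<And>u. u \<in> D \<Longrightarrow> u \<in> carrier R" using DE(1) by auto
    have inv: "\<And>u. u \<in> D \<Longrightarrow> u \<noteq> \<zero> \<Longrightarrow> inv u \<in> carrier R \<and> u \<otimes> inv u = \<one> \<and> inv u \<noteq> \<zero> \<and> inv (inv u) = u"
      using carr field_Units
      by (metis Diff_iff Units_inv_closed Units_inv_inv Units_r_inv empty_iff insert_iff r_null zero_not_one)
    have nz: "\<And>u v. u \<in> D \<Longrightarrow> v \<in> D \<Longrightarrow> u \<noteq> \<zero> \<Longrightarrow> v \<noteq> \<zero> \<Longrightarrow> u \<otimes> v \<noteq> \<zero>"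
      using carr integral by blast
    have inv_mult: "\<And>u v. u \<in> D \<Longrightarrow> v \<in> D \<Longrightarrow> u \<noteq> \<zero> \<Longrightarrow> v \<noteq> \<zero> \<Longrightarrow> inv (u \<otimes> v) = inv u \<otimes> inv v"
    proof -
      fix u v assume uv: "u \<in> D" "v \<in> D" "u \<noteq> \<zero>" "v \<noteq> \<zero>"
      have C: "u \<in> carrier R" "v \<in> carrier R" "inv u \<in> carrier R" "inv v \<in> carrier R"
        using uv carr inv by auto
      have "(u \<otimes> v) \<otimes> (inv u \<otimes> inv v) = (u \<otimes> inv u) \<otimes> (v \<otimes> inv v)"
        using C by algebra
      thus "inv (u \<otimes> v) = inv u \<otimes> inv v"
        using C inv uv by (intro comm_inv_char) auto
    qed
    have FI: "\<And>u v. u \<in> D \<Longrightarrow> v \<in> D \<Longrightarrow> v \<noteq> \<zero> \<Longrightarrow> u \<otimes> inv v \<in> ?F"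
      by blast
    show "?F \<subseteq> carrier R" using carr inv by auto
    show "\<one> \<in> ?F" using DE(3) by (auto intro!: exI[of _ \<one>])
    fix h assume "h \<in> ?F"
    then obtain u v where uv: "h = u \<otimes> inv v" "u \<in> D" "v \<in> D" "v \<noteq> \<zero>" by blast
    have "\<ominus> h = (\<ominus> u) \<otimes> inv v" using uv carr inv by (simp add: l_minus)
    thus "\<ominus> h \<in> ?F" using FI[of "\<ominus> u" v] uv DE(5) by simp
    fix h' assume "h' \<in> ?F"
    then obtain u' v' where uv': "h' = u' \<otimes> inv v'" "u' \<in> D" "v' \<in> D" "v' \<noteq> \<zero>" by blast
    have C: "u \<in> carrier R" "v \<in> carrier R" "u' \<in> carrier R" "v' \<in> carrier R" "inv v \<in> carrier R" "inv v' \<in> carrier R"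
      using uv uv' carr inv by auto
    have "h \<otimes> h' = (u \<otimes> u') \<otimes> (inv v \<otimes> inv v')"
      using C unfolding uv uv' by algebra
    also have "inv v \<otimes> inv v' = inv (v \<otimes> v')" using uv uv' inv_mult by simp
    finally show "h \<otimes> h' \<in> ?F" using FI[of "u \<otimes> u'" "v \<otimes> v'"] uv uv' DE(6) nz by simp
    have "h \<oplus> h' = (u \<otimes> (v' \<otimes> inv v') \<otimes> inv v) \<oplus> (u' \<otimes> (v \<otimes> inv v) \<otimes> inv v')"
      using inv[of v] inv[of v'] uv uv' C by simp
    also have "\<dots> = (u \<otimes> v' \<oplus> u' \<otimes> v) \<otimes> (inv v \<otimes> inv v')"
      using C by (intro add_fractions)
    also have "inv v \<otimes> inv v' = inv (v \<otimes> v')" using uv uv' inv_mult by simp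
    finally show "h \<oplus> h' \<in> ?F"
      using FI[of "u \<otimes> v' \<oplus> u' \<otimes> v" "v \<otimes> v'"] uv uv' DE(6,7) nz by simp
  next
    note DE = subringE[OF D]
    fix h assume "h \<in> ?F - {\<zero>}"
    then obtain u v where uv: "h = u \<otimes> inv v" "u \<in> D" "v \<in> D" "v \<noteq> \<zero>" "h \<noteq> \<zero>" by blast
    have C: "u \<in> carrier R" "v \<in> carrier R" "inv v \<in> carrier R" "v \<otimes> inv v = \<one>"
      using uv DE(1) field_Units by auto
    have "u \<noteq> \<zero>" using uv C by auto
    hence U: "inv u \<in> carrier R" "u \<otimes> inv u = \<one>" using C field_Units by auto
    have "(v \<otimes> inv u) \<otimes> h = (u \<otimes> inv u) \<otimes> (v \<otimes> inv v)"
      using C U unfolding uv by algebra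
    hence "h \<otimes> (v \<otimes> inv u) = \<one>" using C U uv(1) by (simp add: m_comm)
    hence "inv h = v \<otimes> inv u" using C U uv(1) by (intro comm_inv_char) auto
    thus "inv h \<in> ?F" using uv \<open>u \<noteq> \<zero>\<close> by blast
  qed
  thus ?thesis by (simp only: fractions_def)
qed

text \<open>
  Clears denominators in an algebraic relation over a fraction field, turning it into a relation
  over the subring.
\<close>

lemma common_denominator:
  assumes D: "subring D R" and c: "\<And>i. i < (n::nat) \<Longrightarrow> c i \<in> fractions D"
  shows "\<exists>w\<in>D - {\<zero>}. \<forall>i<n. c i \<otimes> w \<in> D"
  using c
proof (induction n)
  case 0
  then show ?case using subringE(3)[OF D] by auto
next
  case (Suc n)
  then obtain w where w: "w \<in> D" "w \<noteq> \<zero>" "\<And>i. i < n \<Longrightarrow> c i \<otimes> w \<in> D" by auto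
  obtain u v where uv: "c n = u \<otimes> inv v" "u \<in> D" "v \<in> D" "v \<noteq> \<zero>" using Suc.prems[of n] by (auto simp: fractions_def)
  note DE = subringE[OF D]
  have C: "u \<in> carrier R" "v \<in> carrier R" "w \<in> carrier R" "inv v \<in> carrier R" "v \<otimes> inv v = \<one>"
    using w uv DE(1) field_Units by auto
  have "c i \<otimes> (w \<otimes> v) \<in> D" if "i < Suc n" for i
  proof (cases "i = n")
    case True
    have "c i \<otimes> (w \<otimes> v) = u \<otimes> w \<otimes> (v \<otimes> inv v)"
      using C(1-4) unfolding True uv by algebra
    thus ?thesis using C w uv DE(6) by simp
  next
    case False
    then have i: "i < n" using that by simp
    obtain u' v' where uv': "c i = u' \<otimes> inv v'" "u' \<in> D" "v' \<in> D" "v' \<noteq> \<zero>" using Suc.prems[of i] i by (auto simp: fractions_def)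
    hence "c i \<in> carrier R" using DE(1) field_Units by auto
    hence "c i \<otimes> (w \<otimes> v) = (c i \<otimes> w) \<otimes> v" using C by algebra
    thus ?thesis using w(3)[OF i] uv DE(6) by simp
  qed
  moreover have "w \<otimes> v \<in> D - {\<zero>}" using C w uv DE(6) integral[of w v] by auto
  ultimately show ?case by blast
qed

text \<open>
  The relative algebraic closure, a closure operator with the exchange property: the operator of
  the matroid whose bases are the transcendence bases.
\<close>

definition acl :: "'a set \<Rightarrow> 'a set" where
  "acl A = {x \<in> carrier R. (algebraic over (generate_field R A)) x}"

lemma generate_field_mono: "A \<subseteq> B \<Longrightarrow> generate_field R A \<subseteq> generate_field R B"
proof
  fix x assume AB: "A \<subseteq> B" and "x \<in> generate_field R A"
  from this(2) show "x \<in> generate_field R B"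
    by (induction rule: generate_field.induct) (use AB in \<open>auto intro: generate_field.intros\<close>)
qed

lemma generate_field_finitary:
  "x \<in> generate_field R A \<Longrightarrow> \<exists>F. finite F \<and> F \<subseteq> A \<and> x \<in> generate_field R F"
proof (induction rule: generate_field.induct)
  case one
  then show ?case by (auto intro: generate_field.one)
next
  case (incl h)
  then show ?case by (intro exI[of _ "{h}"]) (auto intro: generate_field.incl)
next
  case (a_inv h)
  then show ?case by (auto intro: generate_field.a_inv)
next
  case (m_inv h)
  then show ?case by (auto intro: generate_field.m_inv)
next
  case (eng_add h1 h2)
  then obtain F1 F2 where F: "finite F1" "F1 \<subseteq> A" "h1 \<in> generate_field R F1"
    "finite F2" "F2 \<subseteq> A" "h2 \<in> generate_field R F2" by blast
  then show ?case
    using generate_field_mono[of F1 "F1 \<union> F2"] generate_field_mono[of F2 "F1 \<union> F2"]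
    by (intro exI[of _ "F1 \<union> F2"]) (auto intro!: generate_field.eng_add)
next
  case (eng_mult h1 h2)
  then obtain F1 F2 where F: "finite F1" "F1 \<subseteq> A" "h1 \<in> generate_field R F1"
    "finite F2" "F2 \<subseteq> A" "h2 \<in> generate_field R F2" by blast
  then show ?case
    using generate_field_mono[of F1 "F1 \<union> F2"] generate_field_mono[of F2 "F1 \<union> F2"]
    by (intro exI[of _ "F1 \<union> F2"]) (auto intro!: generate_field.eng_mult)
qed

lemma acl_in_carrier: "acl A \<subseteq> carrier R"
  by (auto simp: acl_def)

lemma acl_mono: "A \<subseteq> B \<Longrightarrow> acl A \<subseteq> acl B"
  using algebraic_mono[OF generate_field_mono] by (auto simp: acl_def)

lemma generate_field_subset_acl: "A \<subseteq> carrier R \<Longrightarrow> generate_field R A \<subseteq> acl A"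
  using algebraic_self[OF subfieldE(1)[OF generate_field_is_subfield]] generate_field_in_carrier
  by (auto simp: acl_def)

lemma subset_acl: "A \<subseteq> carrier R \<Longrightarrow> A \<subseteq> acl A"
  using generate_field_subset_acl[of A] by (auto intro: generate_field.incl)

lemma acl_finitary:
  assumes A: "A \<subseteq> carrier R" and x: "x \<in> acl A"
  shows "\<exists>F. finite F \<and> F \<subseteq> A \<and> x \<in> acl F"
proof -
  obtain p where p: "p \<in> carrier ((generate_field R A)[X])" "p \<noteq> []" "eval p x = \<zero>"
    using algebraicE[OF subfieldE(1)[OF generate_field_is_subfield[OF A]]] x by (auto simp: acl_def)
  hence "set p \<subseteq> generate_field R A" by (auto simp: univ_poly_def polynomial_def)
  hence "\<forall>c\<in>set p. \<exists>F. finite F \<and> F \<subseteq> A \<and> c \<in> generate_field R F"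
    using generate_field_finitary by blast
  then obtain F where F: "\<And>c. c \<in> set p \<Longrightarrow> finite (F c) \<and> F c \<subseteq> A \<and> c \<in> generate_field R (F c)"
    by metis
  let ?F = "\<Union>c\<in>set p. F c"
  have "set p \<subseteq> generate_field R ?F"
  proof
    fix c assume "c \<in> set p"
    thus "c \<in> generate_field R ?F" using F[of c] generate_field_mono[of "F c" ?F] by auto
  qed
  hence "p \<in> carrier ((generate_field R ?F)[X])" using p by (auto simp: univ_poly_def polynomial_def)
  hence "(algebraic over (generate_field R ?F)) x" using algebraicI p by blast
  moreover have "x \<in> carrier R" using x acl_in_carrier by auto
  ultimately show ?thesis using F by (intro exI[of _ ?F]) (auto simp: acl_def)
qed

text \<open>
  Over \<open>K\<close>, the field generated by \<open>A\<close>, the hypothesis on \<open>x\<close> gives, after clearing denominators,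
  a relation \<open>\<Sum>\<^sub>i (\<Sum>\<^sub>j d i j a\<^sup>j) x\<^sup>i = 0\<close> with coefficients in \<open>K\<close>. Sorted by powers of \<open>a\<close>, it is a
  relation for \<open>a\<close> with coefficients \<open>e j = \<Sum>\<^sub>i d i j x\<^sup>i\<close>, and it is not trivial: some \<open>e j\<close> has a
  nonzero \<open>d i j\<close>, and cannot vanish since \<open>x\<close> is transcendental over \<open>K\<close>.
\<close>

lemma acl_exchange:
  assumes A: "A \<subseteq> carrier R" and a: "a \<in> carrier R"
    and x: "x \<in> acl (insert a A)" and nx: "x \<notin> acl A"
  shows "a \<in> acl (insert x A)"
proof -
  let ?K = "generate_field R A"
  let ?D = "simple_extension ?K a"
  let ?F = "fractions ?D"
  have xR: "x \<in> carrier R" using x acl_in_carrier by auto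
  have K: "subfield ?K R" using generate_field_is_subfield[OF A] .
  note Kr = subfieldE(1)[OF K]
  have KR: "?K \<subseteq> carrier R" using subringE(1)[OF Kr] .
  have D: "subring ?D R" using simple_extension_is_subring[OF Kr a] .
  have DR: "?D \<subseteq> carrier R" using subringE(1)[OF D] .
  have D_F: "?D \<subseteq> ?F"
  proof
    fix u assume "u \<in> ?D"
    moreover from this have "u = u \<otimes> inv \<one>" using DR by auto
    moreover have "\<one> \<in> ?D" "\<one> \<noteq> \<zero>" using subringE(3)[OF D] by auto
    ultimately show "u \<in> ?F" unfolding fractions_def by (intro CollectI exI[of _ u] exI[of _ "\<one>"]) simp
  qed
  have "insert a A \<subseteq> ?D"
    using simple_extension_mem[OF Kr a] simple_extension_incl[OF KR a] generate_field.incl by fastforce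
  hence "generate_field R (insert a A) \<subseteq> ?F"
    using generate_field_min_subfield1[OF _ fractions_subfield[OF D], of "insert a A"] A a D_F by blast
  hence alg: "(algebraic over ?F) x" using x algebraic_mono by (auto simp: acl_def)
  obtain c k n where c: "\<And>i. c i \<in> ?F" "k < n" "c k \<noteq> \<zero>" "(\<Oplus>i\<in>{..<n::nat}. c i \<otimes> x [^] i) = \<zero>"
    by (rule algebraicE_finsum[OF subfieldE(1)[OF fractions_subfield[OF D]] xR alg]) blast
  have "\<exists>w\<in>?D - {\<zero>}. \<forall>i<n. c i \<otimes> w \<in> ?D"
    using common_denominator[OF D, of n c] c(1) by blast
  then obtain w where w: "w \<in> ?D" "w \<noteq> \<zero>" "\<And>i. i < n \<Longrightarrow> c i \<otimes> w \<in> ?D"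
    by blast
  have cR: "c i \<in> carrier R" for i using subringE(1)[OF subfieldE(1)[OF fractions_subfield[OF D]]] c(1)[of i] by blast
  have wR: "w \<in> carrier R" using w(1) DR by auto
  have "\<exists>q. q \<in> carrier (?K[X]) \<and> c i \<otimes> w = eval q a" if "i < n" for i
    using w(3)[OF that] simple_extension_as_eval_img[OF KR a] by auto
  then obtain q where q: "\<And>i. i < n \<Longrightarrow> q i \<in> carrier (?K[X]) \<and> c i \<otimes> w = eval (q i) a"
    by metis
  \<comment> \<open>A common bound for the lengths turns the coefficients into one rectangular array \<open>d i j\<close>.\<close>
  define m where "m = Max ((\<lambda>i. length (q i)) ` {..<n})"
  have m: "length (q i) \<le> m" if "i < n" for i unfolding m_def using that by (intro Max_ge) auto
  have qK: "set (q i) \<subseteq> ?K" if "i < n" for i using q[OF that] by (auto simp: univ_poly_def polynomial_def)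
  hence qR: "set (q i) \<subseteq> carrier R" if "i < n" for i using KR that by blast
  define d where "d = (\<lambda>i. coeff (q i))"
  have dK: "d i j \<in> ?K" if "i < n" for i j
  proof -
    have "d i j \<in> set (q i) \<union> {\<zero>}"
      using coeff_img(3)[of "q i"] unfolding d_def by (metis rangeI)
    thus ?thesis using qK[OF that] subringE(2)[OF Kr] by auto
  qed
  hence dR: "d i j \<in> carrier R" if "i < n" for i j using that KR by blast
  have cw: "c i \<otimes> w = (\<Oplus>j\<in>{..<m}. d i j \<otimes> a [^] j)" if "i < n" for i
    using q[OF that] eval_eq_finsum[OF qR[OF that] a m[OF that]] by (simp add: d_def)
  define e where "e = (\<lambda>j. \<Oplus>i\<in>{..<n}. d i j \<otimes> x [^] i)"
  have eR: "e j \<in> carrier R" for j unfolding e_def using dR xR by (intro finsum_closed) auto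
  have "c k \<otimes> w \<noteq> \<zero>" using integral[OF _ cR wR] c(3) w(2) by auto
  hence "\<exists>j<m. d k j \<noteq> \<zero>"
  proof (rule contrapos_np)
    assume "\<not> (\<exists>j<m. d k j \<noteq> \<zero>)"
    hence "(\<Oplus>j\<in>{..<m}. d k j \<otimes> a [^] j) = \<zero>" using a by (intro add.finprod_one_eqI) auto
    thus "c k \<otimes> w = \<zero>" using cw c(2) by simp
  qed
  then obtain j0 where j0: "j0 < m" "d k j0 \<noteq> \<zero>" by blast
  have ej0: "e j0 \<noteq> \<zero>"
  proof
    assume "e j0 = \<zero>"
    hence "(algebraic over ?K) x"
      using algebraicI_finsum[OF Kr xR, of n "\<lambda>i. d i j0" k] dK c(2) j0 by (auto simp: e_def)
    thus False using nx xR by (simp add: acl_def)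
  qed
  let ?K' = "generate_field R (insert x A)"
  have K': "subring ?K' R" using subfieldE(1)[OF generate_field_is_subfield] A xR by auto
  have eK': "e j \<in> ?K'" for j
  proof -
    have x': "x \<in> ?K'" by (auto intro: generate_field.incl)
    have pow: "x [^] i \<in> ?K'" for i :: nat
      using x' by (induction i) (auto intro: generate_field.one generate_field.eng_mult)
    have "(\<Oplus>i\<in>{..<n'}. d i j \<otimes> x [^] i) \<in> ?K'" if "n' \<le> n" for n'
      using that
    proof (induction n')
      case 0
      then show ?case using subringE(2)[OF K'] by simp
    next
      case (Suc n')
      have "d n' j \<in> ?K'" using dK[of n' j] Suc.prems generate_field_mono[of A "insert x A"] by auto
      moreover have "(\<Oplus>i\<in>{..<Suc n'}. d i j \<otimes> x [^] i) = d n' j \<otimes> x [^] n' \<oplus> (\<Oplus>i\<in>{..<n'}. d i j \<otimes> x [^] i)"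
        using dR xR Suc.prems by (subst lessThan_Suc, subst finsum_insert) auto
      ultimately show ?case
        using Suc pow by (auto intro!: generate_field.eng_add generate_field.eng_mult)
    qed
    thus ?thesis unfolding e_def by simp
  qed
  have "(\<Oplus>j\<in>{..<m}. e j \<otimes> a [^] j) = (\<Oplus>j\<in>{..<m}. \<Oplus>i\<in>{..<n}. d i j \<otimes> x [^] i \<otimes> a [^] j)"
    unfolding e_def using a xR dR
    by (intro finsum_cong' finsum_ldistr) (auto intro!: finsum_closed)
  also have "\<dots> = (\<Oplus>i\<in>{..<n}. \<Oplus>j\<in>{..<m}. d i j \<otimes> x [^] i \<otimes> a [^] j)"
    using a xR dR by (intro finsum_swap) auto
  also have "\<dots> = (\<Oplus>i\<in>{..<n}. w \<otimes> (c i \<otimes> x [^] i))"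
  proof (intro finsum_cong')
    fix i assume "i \<in> {..<n}"
    hence i: "i < n" by simp
    have "(\<Oplus>j\<in>{..<m}. d i j \<otimes> x [^] i \<otimes> a [^] j) = (\<Oplus>j\<in>{..<m}. (d i j \<otimes> a [^] j) \<otimes> x [^] i)"
      using a xR dR[OF i] by (intro finsum_cong') (auto simp: m_ac)
    also have "\<dots> = (\<Oplus>j\<in>{..<m}. d i j \<otimes> a [^] j) \<otimes> x [^] i"
      using a xR dR[OF i] by (intro finsum_ldistr[symmetric]) auto
    also have "\<dots> = w \<otimes> (c i \<otimes> x [^] i)" 
      using cw[OF i, symmetric] cR wR xR by (simp add: m_ac)
    finally show "(\<Oplus>j\<in>{..<m}. d i j \<otimes> x [^] i \<otimes> a [^] j) = w \<otimes> (c i \<otimes> x [^] i)" .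
  qed (use cR wR xR in auto)
  also have "\<dots> = w \<otimes> (\<Oplus>i\<in>{..<n}. c i \<otimes> x [^] i)"
    using cR wR xR by (intro finsum_rdistr[symmetric]) auto
  also have "\<dots> = \<zero>" using c(4) wR by simp
  finally have "(algebraic over ?K') a"
    using algebraicI_finsum[OF K' a, of m e j0] eK' j0(1) ej0 by blast
  thus ?thesis using a by (simp add: acl_def)
qed

text \<open>
  Independence is phrased through the closure operator, as in a matroid. This avoids polynomials in
  several variables: they are replaced by an induction that adjoins one transcendental element
  at a time.
\<close>

definition alg_independent :: "'a set \<Rightarrow> bool" where
  "alg_independent B \<longleftrightarrow> B \<subseteq> carrier R \<and> (\<forall>b\<in>B. b \<notin> acl (B - {b}))"

text \<open>
  Finitariness of the closure makes unions of chains of independent sets independent. A maximal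
  independent set spans, since by exchange it could otherwise be enlarged by any element outside
  its closure.
\<close>

lemma exists_transcendence_basis:
  "\<exists>B. alg_independent B \<and> acl B = carrier R"
proof -
  let ?I = "{B. alg_independent B}"
  have "\<exists>M\<in>?I. \<forall>B\<in>?I. M \<subseteq> B \<longrightarrow> B = M"
  proof (rule subset_Zorn')
    fix C assume C: "subset.chain ?I C"
    hence ind: "\<And>B. B \<in> C \<Longrightarrow> alg_independent B" by (auto simp: subset.chain_def)
    have "b \<notin> acl (\<Union>C - {b})" if b: "b \<in> \<Union>C" for b
    proof
      assume b': "b \<in> acl (\<Union>C - {b})"
      have "\<Union>C - {b} \<subseteq> carrier R" using ind by (auto simp: alg_independent_def)
      from acl_finitary[OF this b']
      obtain F where F: "finite F" "F \<subseteq> \<Union>C - {b}" "b \<in> acl F"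
        by blast
      have "finite (insert b F)" "insert b F \<subseteq> \<Union>C" using F b by auto
      then obtain B where B: "B \<in> C" "insert b F \<subseteq> B"
        using finite_subset_Union_chain[of "insert b F" C ?I] C b by blast
      have "F \<subseteq> B - {b}" using F B by auto
      hence "b \<in> acl (B - {b})" using acl_mono F(3) by blast
      thus False using ind[OF B(1)] B(2) by (auto simp: alg_independent_def)
    qed
    thus "\<Union>C \<in> ?I" using ind by (auto simp: alg_independent_def)
  qed
  then obtain B where B: "alg_independent B"
    and max: "\<And>B'. alg_independent B' \<Longrightarrow> B \<subseteq> B' \<Longrightarrow> B' = B" by blast
  have BR: "B \<subseteq> carrier R" using B by (simp add: alg_independent_def)
  have "x \<in> acl B" if x: "x \<in> carrier R" for x
  proof (rule ccontr)
    assume nx: "x \<notin> acl B"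
    have xB: "x \<notin> B" using subset_acl[OF BR] nx by auto
    have "alg_independent (insert x B)"
      unfolding alg_independent_def
    proof (intro conjI ballI)
      fix b assume b: "b \<in> insert x B"
      show "b \<notin> acl (insert x B - {b})"
      proof (cases "b = x")
        case True
        thus ?thesis using nx xB by simp
      next
        case False
        hence bB: "b \<in> B" using b by simp
        have eq: "insert x B - {b} = insert x (B - {b})" using False by auto
        have "b \<notin> acl (B - {b})" using B bB by (auto simp: alg_independent_def)
        moreover have "x \<notin> acl (insert b (B - {b}))" using nx bB by (simp add: insert_absorb)
        ultimately show ?thesis
          using acl_exchange[of "B - {b}" x b] BR x unfolding eq by blast
      qed
    qed (use BR x in auto)
    from max[OF this] xB show False by auto
  qed
  thus ?thesis using B acl_in_carrier by blast
qed

end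

section \<open>Cardinality of a transcendence basis\<close>

lemma lepoll_iff_ordLeq: "A \<lesssim> B \<longleftrightarrow> (card_of A, card_of B) \<in> ordLeq"
  by (simp add: lepoll_def card_of_ordLeq)

lemma UN_lepoll_infinite:
  assumes "infinite Z" "I \<lesssim> Z" "\<And>i. i \<in> I \<Longrightarrow> A i \<lesssim> Z"
  shows "(\<Union>i\<in>I. A i) \<lesssim> Z"
  using card_of_UNION_ordLeq_infinite[of Z I A] assms by (simp add: lepoll_iff_ordLeq)

lemma UN_nat_lepoll_infinite:
  fixes A :: "nat \<Rightarrow> 'a set"
  assumes "infinite Z" "\<And>n. A n \<lesssim> Z"
  shows "(\<Union>n. A n) \<lesssim> Z"
  using assms by (intro UN_lepoll_infinite) (auto simp: infinite_le_lepoll)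

lemma times_lepoll_infinite:
  assumes "infinite Z" "A \<lesssim> Z" "B \<lesssim> Z"
  shows "A \<times> B \<lesssim> Z"
proof -
  have "A \<times> B = (\<Union>a\<in>A. Pair a ` B)" by auto
  also have "\<dots> \<lesssim> Z"
    using assms by (intro UN_lepoll_infinite) (auto intro: lepoll_trans[OF image_lepoll])
  finally show ?thesis .
qed

lemma Un_lepoll_infinite:
  assumes "infinite Z" "A \<lesssim> Z" "B \<lesssim> Z"
  shows "A \<union> B \<lesssim> Z"
proof -
  have "A \<union> B = (\<Union>c\<in>{True, False}. if c then A else B)" by auto
  also have "\<dots> \<lesssim> Z"
    using assms by (intro UN_lepoll_infinite) (auto intro: finite_lepoll_infinite)
  finally show ?thesis .
qed

lemma lists_lepoll_infinite:
  assumes "infinite Z" "Y \<lesssim> Z"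
  shows "lists Y \<lesssim> Z"
proof -
  have "{xs. set xs \<subseteq> Y \<and> length xs = n} \<lesssim> Z" for n
  proof (induction n)
    case 0
    have "{xs. set xs \<subseteq> Y \<and> length xs = 0} = {[]}" by auto
    then show ?case using assms(1) by (simp add: finite_lepoll_infinite)
  next
    case (Suc n)
    have "{xs. set xs \<subseteq> Y \<and> length xs = Suc n}
      = (\<lambda>(y, ys). y # ys) ` (Y \<times> {xs. set xs \<subseteq> Y \<and> length xs = n})"
      by (auto simp: length_Suc_conv image_iff)
    also have "\<dots> \<lesssim> Z"
      using times_lepoll_infinite[OF assms Suc.IH] by (rule lepoll_trans[OF image_lepoll])
    finally show ?case .
  qed
  hence "(\<Union>n. {xs. set xs \<subseteq> Y \<and> length xs = n}) \<lesssim> Z"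
    by (rule UN_nat_lepoll_infinite[OF assms(1)])
  moreover have "lists Y = (\<Union>n. {xs. set xs \<subseteq> Y \<and> length xs = n})" by auto
  ultimately show ?thesis by simp
qed

context field
begin

text \<open>
  The generated field is exhausted by countably many stages, each of which applies the field
  operations once to the elements of the previous one.
\<close>

lemma generate_field_lepoll:
  assumes inf: "infinite Z"
  shows "generate_field R Z \<lesssim> Z"
proof -
  define step where "step = (\<lambda>Y. {\<one>} \<union> Y \<union> (a_inv R) ` Y \<union> (m_inv R) ` Y
    \<union> (\<lambda>(x, y). x \<oplus> y) ` (Y \<times> Y) \<union> (\<lambda>(x, y). x \<otimes> y) ` (Y \<times> Y))"
  define Y where "Y = (\<lambda>n. (step ^^ n) Z)"
  have Suc: "Y (Suc n) = step (Y n)" for n by (simp add: Y_def)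
  have "Y n \<lesssim> Z" for n
  proof (induction n)
    case 0
    then show ?case by (simp add: Y_def)
  next
    case (Suc n)
    then show ?case
      unfolding \<open>Y (Suc n) = step (Y n)\<close> step_def
      using inf
      by (intro Un_lepoll_infinite) (auto intro!: lepoll_trans[OF image_lepoll] times_lepoll_infinite
          intro: finite_lepoll_infinite)
  qed
  hence le: "(\<Union>n. Y n) \<lesssim> Z"
    by (rule UN_nat_lepoll_infinite[OF inf])
  have "incseq Y"
    by (rule incseq_SucI) (auto simp: Suc step_def)
  hence mono: "Y m \<subseteq> Y n" if "m \<le> n" for m n using that by (auto simp: incseq_def)
  have "generate_field R Z \<subseteq> (\<Union>n. Y n)"
  proof
    fix x assume "x \<in> generate_field R Z"
    hence "\<exists>n. x \<in> Y n"
    proof (induction rule: generate_field.induct)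
      case one
      have "\<one> \<in> Y (Suc 0)" by (simp add: Suc step_def)
      then show ?case ..
    next
      case (incl h)
      then have "h \<in> Y 0" by (simp add: Y_def)
      then show ?case ..
    next
      case (a_inv h)
      then obtain n where "h \<in> Y n" by blast
      hence "\<ominus> h \<in> Y (Suc n)" by (auto simp: Suc step_def)
      then show ?case ..
    next
      case (m_inv h)
      then obtain n where "h \<in> Y n" by blast
      hence "inv h \<in> Y (Suc n)" by (auto simp: Suc step_def)
      then show ?case ..
    next
      case (eng_add h1 h2)
      then obtain m n where "h1 \<in> Y m" "h2 \<in> Y n" by blast
      hence "h1 \<in> Y (max m n)" "h2 \<in> Y (max m n)" using mono[of m "max m n"] mono[of n "max m n"] by auto
      hence "h1 \<oplus> h2 \<in> Y (Suc (max m n))" by (force simp: Suc step_def)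
      then show ?case ..
    next
      case (eng_mult h1 h2)
      then obtain m n where "h1 \<in> Y m" "h2 \<in> Y n" by blast
      hence "h1 \<in> Y (max m n)" "h2 \<in> Y (max m n)" using mono[of m "max m n"] mono[of n "max m n"] by auto
      hence "h1 \<otimes> h2 \<in> Y (Suc (max m n))" by (force simp: Suc step_def)
      then show ?case ..
    qed
    thus "x \<in> (\<Union>n. Y n)" by blast
  qed
  thus ?thesis using le by (meson lepoll_trans subset_imp_lepoll)
qed

text \<open>
  There are at most as many polynomials over the generated field as elements of \<open>Z\<close>, and each has
  finitely many roots.
\<close>

lemma acl_lepoll:
  assumes Z: "Z \<subseteq> carrier R" and inf: "infinite Z"
  shows "acl Z \<lesssim> Z"
proof -
  let ?K = "generate_field R Z"
  let ?P = "carrier (?K[X])"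
  have K: "subring ?K R" using subfieldE(1)[OF generate_field_is_subfield[OF Z]] .
  have "?P \<subseteq> lists ?K" by (auto simp: univ_poly_def polynomial_def)
  hence P: "?P \<lesssim> Z"
    using lists_lepoll_infinite[OF inf generate_field_lepoll[OF inf]]
    by (meson lepoll_trans subset_imp_lepoll)
  have "(\<Union>p\<in>?P. {x. is_root p x}) \<lesssim> Z"
  proof (rule UN_lepoll_infinite[OF inf P])
    fix p assume "p \<in> ?P"
    hence "finite {x. is_root p x}"
      using finite_number_of_roots carrier_polynomial_shell[OF K] by blast
    thus "{x. is_root p x} \<lesssim> Z" using inf by (rule finite_lepoll_infinite[rotated])
  qed
  moreover have "acl Z \<subseteq> (\<Union>p\<in>?P. {x. is_root p x})"
  proof
    fix x assume "x \<in> acl Z"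
    hence "x \<in> carrier R" "(algebraic over ?K) x" by (auto simp: acl_def)
    from algebraicE[OF K this] obtain p where "p \<in> ?P" "p \<noteq> []" "eval p x = \<zero>" by blast
    thus "x \<in> (\<Union>p\<in>?P. {x. is_root p x})" using \<open>x \<in> carrier R\<close> by (auto simp: is_root_def)
  qed
  ultimately show ?thesis by (meson lepoll_trans subset_imp_lepoll)
qed

text \<open>
  A finite basis would, after adding a countably infinite set, force the field to be countable, so
  the bound for infinite sets applies.
\<close>

lemma exists_eqpoll_transcendence_basis:
  assumes "uncountable (carrier R)"
  shows "\<exists>B. alg_independent B \<and> acl B = carrier R \<and> B \<approx> carrier R"
proof -
  obtain B where B: "alg_independent B" "acl B = carrier R"
    using exists_transcendence_basis by blast
  have BR: "B \<subseteq> carrier R" using B(1) by (simp add: alg_independent_def)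
  have "infinite (carrier R)" using assms countable_finite by blast
  then obtain C where C: "infinite C" "countable C" "C \<subseteq> carrier R"
    using infinite_countable_subset' by blast
  have "infinite B"
  proof
    assume "finite B"
    have "acl (B \<union> C) \<lesssim> B \<union> C" using BR C by (intro acl_lepoll) auto
    moreover have "countable (B \<union> C)" using C \<open>finite B\<close> countable_finite by blast
    ultimately have "countable (acl (B \<union> C))" using countable_lepoll by blast
    hence "countable (acl B)" using acl_mono[of B "B \<union> C"] countable_subset by blast
    thus False using B(2) assms by simp
  qed
  hence "carrier R \<lesssim> B" using acl_lepoll[OF BR] B(2) by simp
  hence "B \<approx> carrier R" using BR by (simp add: lepoll_antisym subset_imp_lepoll)
  thus ?thesis using B by blast
qed

end

section \<open>Partial isomorphisms and their extension\<close>

lemma (in ring) eval_smult: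
  assumes "c \<in> carrier R" "set p \<subseteq> carrier R" "x \<in> carrier R"
  shows "eval (map (\<lambda>a. c \<otimes> a) p) x = c \<otimes> eval p x"
  using assms(2) by (induction p) (use assms eval_in_carrier in \<open>auto simp: r_distr m_assoc\<close>)

text \<open>
  Reversing the coefficients of a polynomial exchanges its values at \<open>u\<close> and at \<open>1/u\<close>, up to a
  power of \<open>u\<close>. This is what makes partial isomorphisms extend to inverses by the same criterion as
  to other elements.
\<close>

lemma (in cring) eval_rev:
  assumes "set p \<subseteq> carrier R" "u \<in> carrier R" "v \<in> carrier R" "u \<otimes> v = \<one>"
  shows "u [^] length p \<otimes> eval p v = u \<otimes> eval (rev p) u"
  using assms(1)
proof (induction p)
  case Nil
  then show ?case using assms by simp
next
  case (Cons a p)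
  have C: "a \<in> carrier R" "set p \<subseteq> carrier R" "eval p v \<in> carrier R" "eval (rev p) u \<in> carrier R"
    using Cons.prems assms eval_in_carrier[of p v] eval_in_carrier[of "rev p" u] by auto
  have uv: "u [^] n \<otimes> v [^] n = \<one>" for n :: nat
    using assms by (simp add: nat_pow_distrib[symmetric] nat_pow_one)
  have "u [^] length (a # p) \<otimes> eval (a # p) v
      = a \<otimes> u \<otimes> (u [^] length p \<otimes> v [^] length p) \<oplus> u \<otimes> (u [^] length p \<otimes> eval p v)"
    using C assms(2,3) by (simp add: r_distr m_ac)
  also have "\<dots> = u \<otimes> ((eval (rev p) u \<otimes> u) \<oplus> a)"
    unfolding uv using Cons.IH[OF C(2)] C assms(2,3) by (simp add: r_distr m_ac a_ac)
  also have "\<dots> = u \<otimes> eval (rev (a # p)) u"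
    using C assms by (simp add: eval_append_aux)
  finally show ?case .
qed

lemma (in domain) transcendental_eval_eq_zero_iff:
  assumes K: "subring K R" and t: "(transcendental over K) a" and a: "a \<in> carrier R" and p: "set p \<subseteq> K"
  shows "eval p a = \<zero> \<longleftrightarrow> set p \<subseteq> {\<zero>}"
proof
  have pR: "set p \<subseteq> carrier R" using p subringE(1)[OF K] by auto
  {
    assume "eval p a = \<zero>"
    hence "eval (normalize p) a = \<zero>" using eval_normalize[OF pR a] by simp
    moreover have "normalize p \<in> carrier (K[X])"
      using normalize_gives_polynomial[OF p] by (simp add: univ_poly_carrier)
    ultimately have "normalize p = []" using eval_transcendental[OF t] by blast
    thus "set p \<subseteq> {\<zero>}" by (metis append_Nil2 normalize_trick set_replicate_conv_if subset_refl empty_subsetI)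
  }
  assume "set p \<subseteq> {\<zero>}"
  thus "eval p a = \<zero>" using a by (induction p) auto
qed

lemma (in algebraically_closed) exists_root:
  assumes "p \<in> carrier (poly_ring L)" "length p > 1"
  shows "\<exists>x\<in>carrier L. eval p x = \<zero>"
proof -
  have "size (roots p) = length p - 1"
    using roots_over_carrier[OF assms(1)] by (simp add: splitted_def)
  hence "roots p \<noteq> {#}" using assms(2) by auto
  then obtain x where "x \<in># roots p" by blast
  hence "is_root p x" using roots_mem_iff_is_root[OF assms(1)] by simp
  thus ?thesis by (auto simp: is_root_def)
qed

lemma (in domain) nat_pow_nonzero:
  "x \<in> carrier R \<Longrightarrow> x \<noteq> \<zero> \<Longrightarrow> x [^] (n::nat) \<noteq> \<zero>"
  by (induction n) (auto dest: integral)

locale field_pair = R: field R + S: field S for R (structure) and S (structure)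
begin

text \<open>
  A partial isomorphism is represented by its graph, a subring of the product of the two fields.
  The last condition says that both projections of the graph are injective, so the graph is that of
  an isomorphism between a subring of \<open>R\<close> and a subring of \<open>S\<close>. Graphs are symmetric in the two
  fields and make unions of chains trivial. The pair of elements \<open>-1\<close>
  gives closure under negation and, as its square, the pair of units.
\<close>

definition partial_iso :: "('a \<times> 'c) set \<Rightarrow> bool" where
  "partial_iso G \<longleftrightarrow> G \<subseteq> carrier R \<times> carrier S \<and> (\<ominus>\<^bsub>R\<^esub> \<one>\<^bsub>R\<^esub>, \<ominus>\<^bsub>S\<^esub> \<one>\<^bsub>S\<^esub>) \<in> G \<and>
     (\<forall>x y x' y'. (x, y) \<in> G \<longrightarrow> (x', y') \<in> G \<longrightarrow>
        (x \<oplus>\<^bsub>R\<^esub> x', y \<oplus>\<^bsub>S\<^esub> y') \<in> G \<and> (x \<otimes>\<^bsub>R\<^esub> x', y \<otimes>\<^bsub>S\<^esub> y') \<in> G) \<and>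
     (\<forall>x y. (x, y) \<in> G \<longrightarrow> (x = \<zero>\<^bsub>R\<^esub> \<longleftrightarrow> y = \<zero>\<^bsub>S\<^esub>))"

lemma partial_isoD:
  assumes "partial_iso G"
  shows "(x, y) \<in> G \<Longrightarrow> x \<in> carrier R" "(x, y) \<in> G \<Longrightarrow> y \<in> carrier S"
    "(\<ominus>\<^bsub>R\<^esub> \<one>\<^bsub>R\<^esub>, \<ominus>\<^bsub>S\<^esub> \<one>\<^bsub>S\<^esub>) \<in> G"
    "(x, y) \<in> G \<Longrightarrow> (x', y') \<in> G \<Longrightarrow> (x \<oplus>\<^bsub>R\<^esub> x', y \<oplus>\<^bsub>S\<^esub> y') \<in> G"
    "(x, y) \<in> G \<Longrightarrow> (x', y') \<in> G \<Longrightarrow> (x \<otimes>\<^bsub>R\<^esub> x', y \<otimes>\<^bsub>S\<^esub> y') \<in> G"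
    "(x, y) \<in> G \<Longrightarrow> x = \<zero>\<^bsub>R\<^esub> \<longleftrightarrow> y = \<zero>\<^bsub>S\<^esub>"
  using assms by (auto simp: partial_iso_def)

lemma partial_iso_uminus:
  assumes "partial_iso G" "(x, y) \<in> G"
  shows "(\<ominus>\<^bsub>R\<^esub> x, \<ominus>\<^bsub>S\<^esub> y) \<in> G"
proof -
  have "(\<ominus>\<^bsub>R\<^esub> \<one>\<^bsub>R\<^esub> \<otimes>\<^bsub>R\<^esub> x, \<ominus>\<^bsub>S\<^esub> \<one>\<^bsub>S\<^esub> \<otimes>\<^bsub>S\<^esub> y) \<in> G"
    using partial_isoD(3,5)[OF assms(1)] assms(2) by blast
  thus ?thesis
    using partial_isoD(1,2)[OF assms] by (simp add: R.l_minus S.l_minus)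
qed

lemma partial_iso_one:
  assumes "partial_iso G" shows "(\<one>\<^bsub>R\<^esub>, \<one>\<^bsub>S\<^esub>) \<in> G"
  using partial_iso_uminus[OF assms partial_isoD(3)[OF assms]] by simp

lemma partial_iso_functional:
  assumes G: "partial_iso G" and "(x, y) \<in> G" "(x, y') \<in> G"
  shows "y = y'"
proof -
  have "(x \<oplus>\<^bsub>R\<^esub> \<ominus>\<^bsub>R\<^esub> x, y \<oplus>\<^bsub>S\<^esub> \<ominus>\<^bsub>S\<^esub> y') \<in> G"
    using assms partial_iso_uminus partial_isoD(4) by blast
  hence "y \<oplus>\<^bsub>S\<^esub> \<ominus>\<^bsub>S\<^esub> y' = \<zero>\<^bsub>S\<^esub>"
    using partial_isoD(6)[OF G] partial_isoD(1)[OF G assms(2)] by (metis R.r_neg)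
  thus ?thesis using partial_isoD(2)[OF G assms(2)] partial_isoD(2)[OF G assms(3)]
    by (simp add: S.minus_eq[symmetric])
qed

lemma partial_iso_homE:
  assumes G: "partial_iso G"
  obtains h where "subring (fst ` G) R" "h \<in> ring_hom (R\<lparr>carrier := fst ` G\<rparr>) S"
    "\<And>x. x \<in> fst ` G \<Longrightarrow> (x, h x) \<in> G" "\<And>x y. (x, y) \<in> G \<Longrightarrow> y = h x"
proof -
  define h where "h = (\<lambda>x. SOME y. (x, y) \<in> G)"
  have h: "(x, h x) \<in> G" if "x \<in> fst ` G" for x
    unfolding h_def using that by (auto intro: someI)
  have h': "y = h x" if "(x, y) \<in> G" for x y
  proof -
    have "x \<in> fst ` G" using imageI[OF that, of fst] by simp
    thus ?thesis using partial_iso_functional[OF G that] h by blast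
  qed
  have "subring (fst ` G) R"
  proof (rule R.subringI)
    have dom: "x \<in> fst ` G" if "(x, y) \<in> G" for x y using imageI[OF that, of fst] by simp
    show "fst ` G \<subseteq> carrier R" using partial_isoD(1)[OF G] by auto
    show "\<one>\<^bsub>R\<^esub> \<in> fst ` G" using dom[OF partial_iso_one[OF G]] by simp
    fix x assume x: "x \<in> fst ` G"
    show "\<ominus>\<^bsub>R\<^esub> x \<in> fst ` G" using dom[OF partial_iso_uminus[OF G h[OF x]]] by simp
    fix y assume y: "y \<in> fst ` G"
    show "x \<otimes>\<^bsub>R\<^esub> y \<in> fst ` G" using dom[OF partial_isoD(5)[OF G h[OF x] h[OF y]]] by simp
    show "x \<oplus>\<^bsub>R\<^esub> y \<in> fst ` G" using dom[OF partial_isoD(4)[OF G h[OF x] h[OF y]]] by simp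
  qed
  moreover have "h \<in> ring_hom (R\<lparr>carrier := fst ` G\<rparr>) S"
  proof (rule ring_hom_memI; simp)
    show "h x \<in> carrier S" if "x \<in> fst ` G" for x using partial_isoD(2)[OF G h[OF that]] .
    fix x y assume xy: "x \<in> fst ` G" "y \<in> fst ` G"
    show "h (x \<otimes>\<^bsub>R\<^esub> y) = h x \<otimes>\<^bsub>S\<^esub> h y" using h'[OF partial_isoD(5)[OF G h h]] xy by simp
    show "h (x \<oplus>\<^bsub>R\<^esub> y) = h x \<oplus>\<^bsub>S\<^esub> h y" using h'[OF partial_isoD(4)[OF G h h]] xy by simp
  next
    show "h \<one>\<^bsub>R\<^esub> = \<one>\<^bsub>S\<^esub>" using h'[OF partial_iso_one[OF G]] by simp
  qed
  ultimately show thesis using that h h' by blast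
qed

text \<open>
  Polynomials over \<open>K\<close> are evaluated simultaneously at \<open>a\<close> and, after transport along \<open>h\<close>, at \<open>b\<close>. The
  lists \<open>r\<close> are the sum and the product of polynomials in \<open>K[x]\<close>; transport along \<open>h\<close> respects them
  only up to leading zeros, which evaluation does not see.
\<close>

lemma pair_eval:
  assumes K: "subring K R" and h: "h \<in> ring_hom (R\<lparr>carrier := K\<rparr>) S"
    and a: "a \<in> carrier R" and b: "b \<in> carrier S" and p: "set p \<subseteq> K" and q: "set q \<subseteq> K"
  shows "\<exists>r. set r \<subseteq> K \<and> R.eval r a = R.eval p a \<oplus>\<^bsub>R\<^esub> R.eval q a
      \<and> S.eval (map h r) b = S.eval (map h p) b \<oplus>\<^bsub>S\<^esub> S.eval (map h q) b" (is ?add)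
    and "\<exists>r. set r \<subseteq> K \<and> R.eval r a = R.eval p a \<otimes>\<^bsub>R\<^esub> R.eval q a
      \<and> S.eval (map h r) b = S.eval (map h p) b \<otimes>\<^bsub>S\<^esub> S.eval (map h q) b" (is ?mult)
proof -
  interpret H: ring_hom_ring "R\<lparr>carrier := K\<rparr>" S h
    using h R.subring_is_ring[OF K] S.ring_axioms by (simp add: ring_hom_ring_def ring_hom_ring_axioms_def)
  have KR: "K \<subseteq> carrier R" using subringE(1)[OF K] .
  have hS: "set (map h r) \<subseteq> carrier S" if "set r \<subseteq> K" for r
  proof -
    have "h x \<in> carrier S" if "x \<in> K" for x using ring_hom_memE(1)[OF h] that by simp
    thus ?thesis unfolding set_map using that by blast
  qed
  have norm: "S.eval (S.normalize (map h r)) b = S.eval (map h r) b" if "set r \<subseteq> K" for r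
    using S.eval_normalize[OF hS[OF that] b] .
  have cl: "set (R.poly_add p q) \<subseteq> K" "set (R.poly_mult p q) \<subseteq> K"
    using R.polynomial_incl[OF R.poly_add_is_polynomial[OF K p q]]
      R.polynomial_incl[OF R.poly_mult_is_polynomial[OF K p q]] by auto
  have pR: "set p \<subseteq> carrier R" "set q \<subseteq> carrier R" using p q KR by auto
  have "S.eval (map h (R.poly_add p q)) b = S.eval (S.poly_add (map h p) (map h q)) b"
    using norm[OF cl(1)] H.poly_add_hom'[of p q] p q R.poly_add_consistent[OF K] by simp
  also have "\<dots> = S.eval (map h p) b \<oplus>\<^bsub>S\<^esub> S.eval (map h q) b"
    by (rule S.eval_poly_add[OF hS[OF p] hS[OF q] b])
  finally show ?add using cl(1) R.eval_poly_add[OF pR a] by blast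
  have "S.eval (map h (R.poly_mult p q)) b = S.eval (S.poly_mult (map h p) (map h q)) b"
    using norm[OF cl(2)] H.poly_mult_hom'[of p q] p q R.poly_mult_consistent[OF K] by simp
  also have "\<dots> = S.eval (map h p) b \<otimes>\<^bsub>S\<^esub> S.eval (map h q) b"
    by (rule S.eval_poly_mult[OF hS[OF p] hS[OF q] b])
  finally show ?mult using cl(2) R.eval_poly_mult[OF pR a] by blast
qed

text \<open>
  The extension criterion behind all three extension steps: if \<open>a\<close> and \<open>b\<close> are roots of the
  same polynomials, then the pairs of values of polynomials at \<open>a\<close> and \<open>b\<close> form the graph of an
  isomorphism between \<open>K[a]\<close> and its image. The coefficient lists may have leading zeros.
\<close>

lemma partial_iso_extend:
  assumes G: "partial_iso G" and K: "subring (fst ` G) R" and h: "h \<in> ring_hom (R\<lparr>carrier := fst ` G\<rparr>) S"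
    and graph: "\<And>x y. (x, y) \<in> G \<Longrightarrow> y = h x"
    and a: "a \<in> carrier R" and b: "b \<in> carrier S"
    and match: "\<And>p. set p \<subseteq> fst ` G \<Longrightarrow> R.eval p a = \<zero>\<^bsub>R\<^esub> \<longleftrightarrow> S.eval (map h p) b = \<zero>\<^bsub>S\<^esub>"
  shows "\<exists>G'. partial_iso G' \<and> G \<subseteq> G' \<and> (a, b) \<in> G'"
proof -
  let ?K = "fst ` G"
  define E where "E = (\<lambda>p. (R.eval p a, S.eval (map h p) b))"
  define G' where "G' = E ` {p. set p \<subseteq> ?K}"
  have KR: "?K \<subseteq> carrier R" using subringE(1)[OF K] .
  have hS: "h x \<in> carrier S" if "x \<in> ?K" for x using ring_hom_memE(1)[OF h] that by simp
  have GG': "G \<subseteq> G'"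
  proof
    fix z assume z: "z \<in> G"
    obtain x y where xy: "z = (x, y)" by force
    have x: "x \<in> ?K" using z xy by force
    hence "E [x] = z"
      using KR hS[OF x] graph[of x y] z a b by (auto simp: E_def xy)
    moreover have "E [x] \<in> G'" unfolding G'_def using x by (intro imageI) simp
    ultimately show "z \<in> G'" by simp
  qed
  have "partial_iso G'"
    unfolding partial_iso_def
  proof (intro conjI allI impI)
    show "G' \<subseteq> carrier R \<times> carrier S"
    proof
      fix z assume "z \<in> G'"
      then obtain p where p: "set p \<subseteq> ?K" "z = E p" by (auto simp: G'_def)
      have "set p \<subseteq> carrier R" "set (map h p) \<subseteq> carrier S" using p KR hS by auto
      thus "z \<in> carrier R \<times> carrier S"
        using R.eval_in_carrier[of p a] S.eval_in_carrier[of "map h p" b] a b by (simp add: p E_def)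
    qed
    show "(\<ominus>\<^bsub>R\<^esub> \<one>\<^bsub>R\<^esub>, \<ominus>\<^bsub>S\<^esub> \<one>\<^bsub>S\<^esub>) \<in> G'" using partial_isoD(3)[OF G] GG' by auto
  next
    fix x y x' y' assume "(x, y) \<in> G'" "(x', y') \<in> G'"
    then obtain p q where p: "set p \<subseteq> ?K" "(x, y) = E p" and q: "set q \<subseteq> ?K" "(x', y') = E q"
      by (auto simp: G'_def)
    obtain r where "set r \<subseteq> ?K" "E r = (x \<oplus>\<^bsub>R\<^esub> x', y \<oplus>\<^bsub>S\<^esub> y')"
      using pair_eval(1)[OF K h a b p(1) q(1)] p(2) q(2) by (auto simp: E_def)
    thus "(x \<oplus>\<^bsub>R\<^esub> x', y \<oplus>\<^bsub>S\<^esub> y') \<in> G'" unfolding G'_def by (metis imageI mem_Collect_eq)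
    obtain r where "set r \<subseteq> ?K" "E r = (x \<otimes>\<^bsub>R\<^esub> x', y \<otimes>\<^bsub>S\<^esub> y')"
      using pair_eval(2)[OF K h a b p(1) q(1)] p(2) q(2) by (auto simp: E_def)
    thus "(x \<otimes>\<^bsub>R\<^esub> x', y \<otimes>\<^bsub>S\<^esub> y') \<in> G'" unfolding G'_def by (metis imageI mem_Collect_eq)
  next
    fix x y assume "(x, y) \<in> G'"
    thus "x = \<zero>\<^bsub>R\<^esub> \<longleftrightarrow> y = \<zero>\<^bsub>S\<^esub>" using match by (auto simp: G'_def E_def)
  qed
  moreover have "(a, b) \<in> G'"
  proof -
    have one: "\<one>\<^bsub>R\<^esub> \<in> ?K" "\<zero>\<^bsub>R\<^esub> \<in> ?K" using subringE(2,3)[OF K] by auto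
    have "h \<one>\<^bsub>R\<^esub> = \<one>\<^bsub>S\<^esub>" using graph[OF partial_iso_one[OF G]] by simp
    moreover obtain y where y: "(\<zero>\<^bsub>R\<^esub>, y) \<in> G" using one(2) by force
    have "h \<zero>\<^bsub>R\<^esub> = \<zero>\<^bsub>S\<^esub>" using graph[OF y] partial_isoD(6)[OF G y] by simp
    ultimately have "E [\<one>\<^bsub>R\<^esub>, \<zero>\<^bsub>R\<^esub>] = (a, b)" using a b by (simp add: E_def)
    moreover have "E [\<one>\<^bsub>R\<^esub>, \<zero>\<^bsub>R\<^esub>] \<in> G'" unfolding G'_def using one by (intro imageI) simp
    ultimately show ?thesis by simp
  qed
  ultimately show ?thesis using GG' by blast
qed

lemma partial_iso_extend_transcendental:
  assumes G: "partial_iso G" and a: "a \<in> carrier R" and b: "b \<in> carrier S"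
    and ta: "(R.transcendental over (fst ` G)) a" and tb: "(S.transcendental over (snd ` G)) b"
  shows "\<exists>G'. partial_iso G' \<and> G \<subseteq> G' \<and> (a, b) \<in> G'"
proof (rule partial_iso_homE[OF G])
  fix h assume K: "subring (fst ` G) R" and h: "h \<in> ring_hom (R\<lparr>carrier := fst ` G\<rparr>) S"
    and hG: "\<And>x. x \<in> fst ` G \<Longrightarrow> (x, h x) \<in> G" and graph: "\<And>x y. (x, y) \<in> G \<Longrightarrow> y = h x"
  interpret H: ring_hom_ring "R\<lparr>carrier := fst ` G\<rparr>" S h
    using h R.subring_is_ring[OF K] S.ring_axioms by (simp add: ring_hom_ring_def ring_hom_ring_axioms_def)
  have "snd ` G = h ` fst ` G" using hG graph by (force simp: image_iff)
  moreover have "subring (h ` fst ` G) S"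
    using H.img_is_subring[OF ring.carrier_is_subring[OF R.subring_is_ring[OF K]]] by simp
  ultimately have L: "subring (snd ` G) S" by simp
  show ?thesis
  proof (rule partial_iso_extend[OF G K h graph a b])
    fix p assume p: "set p \<subseteq> fst ` G"
    have hp: "set (map h p) \<subseteq> snd ` G" using p hG by force
    have "set p \<subseteq> {\<zero>\<^bsub>R\<^esub>} \<longleftrightarrow> set (map h p) \<subseteq> {\<zero>\<^bsub>S\<^esub>}"
      using p partial_isoD(6)[OF G hG] by auto
    thus "R.eval p a = \<zero>\<^bsub>R\<^esub> \<longleftrightarrow> S.eval (map h p) b = \<zero>\<^bsub>S\<^esub>"
      using R.transcendental_eval_eq_zero_iff[OF K ta a p] S.transcendental_eval_eq_zero_iff[OF L tb b hp]
      by simp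
  qed
qed

lemma partial_iso_extend_inverse:
  assumes G: "partial_iso G" and uv: "(u, v) \<in> G" "u \<noteq> \<zero>\<^bsub>R\<^esub>"
  shows "\<exists>G'. partial_iso G' \<and> G \<subseteq> G' \<and> (inv\<^bsub>R\<^esub> u, inv\<^bsub>S\<^esub> v) \<in> G'"
proof (rule partial_iso_homE[OF G])
  fix h assume K: "subring (fst ` G) R" and h: "h \<in> ring_hom (R\<lparr>carrier := fst ` G\<rparr>) S"
    and hG: "\<And>x. x \<in> fst ` G \<Longrightarrow> (x, h x) \<in> G" and graph: "\<And>x y. (x, y) \<in> G \<Longrightarrow> y = h x"
  interpret H: ring_hom_ring "R\<lparr>carrier := fst ` G\<rparr>" S h
    using h R.subring_is_ring[OF K] S.ring_axioms by (simp add: ring_hom_ring_def ring_hom_ring_axioms_def)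
  have KR: "fst ` G \<subseteq> carrier R" using subringE(1)[OF K] .
  have u: "u \<in> carrier R" "inv\<^bsub>R\<^esub> u \<in> carrier R" "u \<otimes>\<^bsub>R\<^esub> inv\<^bsub>R\<^esub> u = \<one>\<^bsub>R\<^esub>"
    using partial_isoD(1)[OF G uv(1)] uv(2) R.field_Units by auto
  have "v \<noteq> \<zero>\<^bsub>S\<^esub>" using partial_isoD(6)[OF G uv(1)] uv(2) by simp
  hence v: "v \<in> carrier S" "v \<noteq> \<zero>\<^bsub>S\<^esub>" "inv\<^bsub>S\<^esub> v \<in> carrier S" "v \<otimes>\<^bsub>S\<^esub> inv\<^bsub>S\<^esub> v = \<one>\<^bsub>S\<^esub>"
    using partial_isoD(2)[OF G uv(1)] S.field_Units by auto
  have uK: "u \<in> fst ` G" using uv(1) by force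
  show ?thesis
  proof (rule partial_iso_extend[OF G K h graph u(2) v(3)])
    fix p assume p: "set p \<subseteq> fst ` G"
    have pR: "set p \<subseteq> carrier R" using p KR by auto
    have pS: "set (map h p) \<subseteq> carrier S" unfolding set_map using p partial_isoD(2)[OF G hG] by blast
    have C: "R.eval p (inv\<^bsub>R\<^esub> u) \<in> carrier R" "R.eval (rev p) u \<in> carrier R"
      "S.eval (map h p) (inv\<^bsub>S\<^esub> v) \<in> carrier S" "S.eval (rev (map h p)) v \<in> carrier S"
      using R.eval_in_carrier[of p "inv\<^bsub>R\<^esub> u"] R.eval_in_carrier[of "rev p" u] pR u
        S.eval_in_carrier[of "map h p" "inv\<^bsub>S\<^esub> v"] S.eval_in_carrier[of "rev (map h p)" v] pS v by auto
    have pow: "u [^]\<^bsub>R\<^esub> n \<noteq> \<zero>\<^bsub>R\<^esub>" "v [^]\<^bsub>S\<^esub> n \<noteq> \<zero>\<^bsub>S\<^esub>" for n :: nat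
      using R.nat_pow_nonzero[OF u(1) uv(2)] S.nat_pow_nonzero[OF v(1,2)] by auto
    have "R.eval p (inv\<^bsub>R\<^esub> u) = \<zero>\<^bsub>R\<^esub> \<longleftrightarrow> u [^]\<^bsub>R\<^esub> length p \<otimes>\<^bsub>R\<^esub> R.eval p (inv\<^bsub>R\<^esub> u) = \<zero>\<^bsub>R\<^esub>"
      using C u(1) pow(1) by (metis R.integral R.nat_pow_closed R.r_null)
    also have "\<dots> \<longleftrightarrow> R.eval (rev p) u = \<zero>\<^bsub>R\<^esub>"
      unfolding R.eval_rev[OF pR u] using C u(1) uv(2) by (metis R.integral R.r_null)
    also have "\<dots> \<longleftrightarrow> S.eval (rev (map h p)) v = \<zero>\<^bsub>S\<^esub>"
    proof -
      have "set (rev p) \<subseteq> fst ` G" using p by simp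
      hence "R.eval (rev p) u \<in> fst ` G"
        using ring.eval_in_carrier[OF R.subring_is_ring[OF K], of "rev p" u] uK R.eval_consistent[OF K] by simp
      hence "(R.eval (rev p) u, h (R.eval (rev p) u)) \<in> G" using hG by blast
      moreover have "h (R.eval (rev p) u) = S.eval (rev (map h p)) v"
        using H.eval_hom'[of u "rev p"] p uK graph[OF uv(1)] R.eval_consistent[OF K] by (simp add: rev_map)
      ultimately show ?thesis using partial_isoD(6)[OF G] by metis
    qed
    also have "\<dots> \<longleftrightarrow> v [^]\<^bsub>S\<^esub> length (map h p) \<otimes>\<^bsub>S\<^esub> S.eval (map h p) (inv\<^bsub>S\<^esub> v) = \<zero>\<^bsub>S\<^esub>"
      unfolding S.eval_rev[OF pS v(1,3,4)] using C v(1,2) by (metis S.integral S.r_null)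
    also have "\<dots> \<longleftrightarrow> S.eval (map h p) (inv\<^bsub>S\<^esub> v) = \<zero>\<^bsub>S\<^esub>"
      using C v(1) pow(2) by (metis S.integral S.nat_pow_closed S.r_null)
    finally show "R.eval p (inv\<^bsub>R\<^esub> u) = \<zero>\<^bsub>R\<^esub> \<longleftrightarrow> S.eval (map h p) (inv\<^bsub>S\<^esub> v) = \<zero>\<^bsub>S\<^esub>" .
  qed
qed

text \<open>
  Here \<open>b\<close> is a root of the transported minimal polynomial of \<open>a\<close>. Every polynomial that vanishes at
  \<open>a\<close> is a multiple of the minimal polynomial, so it vanishes at \<open>b\<close>. Conversely,
  \<open>K[a]\<close> is a field, so a nonzero value at \<open>a\<close> has an inverse that is itself a
  value of a polynomial, and therefore the value at \<open>b\<close> is invertible too.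
\<close>

lemma partial_iso_extend_algebraic:
  assumes G: "partial_iso G" and K: "subfield (fst ` G) R" and closed: "algebraically_closed S"
    and a: "a \<in> carrier R" and alg: "(R.algebraic over (fst ` G)) a"
  shows "\<exists>G' b. partial_iso G' \<and> G \<subseteq> G' \<and> (a, b) \<in> G'"
proof (rule partial_iso_homE[OF G])
  let ?K = "fst ` G"
  fix h assume Kr: "subring ?K R" and h: "h \<in> ring_hom (R\<lparr>carrier := ?K\<rparr>) S"
    and hG: "\<And>x. x \<in> ?K \<Longrightarrow> (x, h x) \<in> G" and graph: "\<And>x y. (x, y) \<in> G \<Longrightarrow> y = h x"
  interpret H: ring_hom_ring "R\<lparr>carrier := ?K\<rparr>" S h
    using h R.subring_is_ring[OF Kr] S.ring_axioms by (simp add: ring_hom_ring_def ring_hom_ring_axioms_def)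
  have KR: "?K \<subseteq> carrier R" using subringE(1)[OF Kr] .
  have hS: "set (map h p) \<subseteq> carrier S" if "set p \<subseteq> ?K" for p
    unfolding set_map using that partial_isoD(2)[OF G hG] by blast
  have h0: "h x = \<zero>\<^bsub>S\<^esub> \<longleftrightarrow> x = \<zero>\<^bsub>R\<^esub>" if "x \<in> ?K" for x
    using partial_isoD(6)[OF G hG[OF that]] by simp
  have map_normalize: "S.normalize (map h p) = map h (R.normalize p)" if "set p \<subseteq> ?K" for p
    using that by (induction p) (auto simp: h0)
  have poly: "R.normalize p \<in> carrier (?K[X]\<^bsub>R\<^esub>)" if "set p \<subseteq> ?K" for p
    using R.normalize_gives_polynomial[OF that] by (simp add: univ_poly_carrier)
  have coeffs: "set p \<subseteq> ?K" if "p \<in> carrier (?K[X]\<^bsub>R\<^esub>)" for p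
    using that by (auto simp: univ_poly_def polynomial_def)
  let ?I = "R.Irr ?K a"
  note I = R.IrrE[OF K a alg]
  have deg: "length ?I > 1" using R.pirreducible_degree[OF K I(1,2)] by simp
  have "map h ?I \<in> carrier (poly_ring S)"
    using hS[OF coeffs[OF I(1)]] deg I(3) H.hom_one
    by (cases ?I) (auto simp: univ_poly_def polynomial_def)
  then obtain b where b: "b \<in> carrier S" "S.eval (map h ?I) b = \<zero>\<^bsub>S\<^esub>"
    using algebraically_closed.exists_root[OF closed, of "map h ?I"] deg by auto
  have root: "S.eval (map h p) b = \<zero>\<^bsub>S\<^esub>" if p: "set p \<subseteq> ?K" "R.eval p a = \<zero>\<^bsub>R\<^esub>" for p
  proof -
    have "R.eval (R.normalize p) a = \<zero>\<^bsub>R\<^esub>" using R.eval_normalize[of p a] p KR a by auto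
    hence "?I pdivides\<^bsub>R\<^esub> (R.normalize p)"
      using R.Irr_minimal[OF K a alg poly[OF p(1)]] by simp
    hence "?I divides\<^bsub>?K[X]\<^bsub>R\<^esub>\<^esub> (R.normalize p)"
      using R.pdivides_iff_shell[OF K I(1) poly[OF p(1)]] by simp
    then obtain q where q: "q \<in> carrier (?K[X]\<^bsub>R\<^esub>)" "R.normalize p = R.poly_mult ?I q"
      by (auto simp: factor_def univ_poly_mult)
    have "S.eval (map h p) b = S.eval (S.normalize (map h p)) b"
      using S.eval_normalize[OF hS[OF p(1)] b(1)] by simp
    also have "S.normalize (map h p) = S.normalize (S.normalize (map h p))"
      using S.normalize_idem[of "map h p" "[]"] by simp
    also have "\<dots> = S.normalize (map h (R.poly_mult ?I q))"
      using map_normalize[OF p(1)] q(2) by simp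
    also have "\<dots> = S.poly_mult (map h ?I) (map h q)"
      using H.poly_mult_hom'[of ?I q] coeffs[OF I(1)] coeffs[OF q(1)] R.poly_mult_consistent[OF Kr] by simp
    also have "S.eval (S.poly_mult (map h ?I) (map h q)) b = S.eval (map h ?I) b \<otimes>\<^bsub>S\<^esub> S.eval (map h q) b"
      using S.eval_poly_mult[OF hS[OF coeffs[OF I(1)]] hS[OF coeffs[OF q(1)]] b(1)] .
    also have "\<dots> = \<zero>\<^bsub>S\<^esub>"
      using b(2) S.eval_in_carrier[OF hS[OF coeffs[OF q(1)]] b(1)] by simp
    finally show ?thesis .
  qed
  have "\<exists>G'. partial_iso G' \<and> G \<subseteq> G' \<and> (a, b) \<in> G'"
  proof (rule partial_iso_extend[OF G Kr h graph a b(1)])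
    fix p assume p: "set p \<subseteq> ?K"
    show "R.eval p a = \<zero>\<^bsub>R\<^esub> \<longleftrightarrow> S.eval (map h p) b = \<zero>\<^bsub>S\<^esub>"
    proof
      assume "R.eval p a = \<zero>\<^bsub>R\<^esub>"
      thus "S.eval (map h p) b = \<zero>\<^bsub>S\<^esub>" using root p by blast
    next
      assume z: "S.eval (map h p) b = \<zero>\<^bsub>S\<^esub>"
      show "R.eval p a = \<zero>\<^bsub>R\<^esub>"
      proof (rule ccontr)
        assume nz: "R.eval p a \<noteq> \<zero>\<^bsub>R\<^esub>"
        let ?E = "R.simple_extension ?K a"
        have E: "subfield ?E R" using R.simple_extension_is_subfield[OF K a] alg by simp
        have pa: "R.eval p a \<in> carrier R" using R.eval_in_carrier[of p a] p KR a by auto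
        have "R.eval p a = R.eval (R.normalize p) a" using R.eval_normalize[of p a] p KR a by auto
        hence "R.eval p a \<in> ?E" using R.simple_extension_as_eval_img[OF KR a] poly[OF p] by blast
        hence "inv\<^bsub>R\<^esub> (R.eval p a) \<in> ?E"
          using R.subfield_m_inv(1)[OF E, of "R.eval p a"] nz by simp
        then obtain q where q: "q \<in> carrier (?K[X]\<^bsub>R\<^esub>)" "inv\<^bsub>R\<^esub> (R.eval p a) = R.eval q a"
          using R.simple_extension_as_eval_img[OF KR a] by blast
        have one: "R.eval p a \<otimes>\<^bsub>R\<^esub> R.eval q a = \<one>\<^bsub>R\<^esub>"
          unfolding q(2)[symmetric] using R.field_Units pa nz by simp
        obtain r where r: "set r \<subseteq> ?K" "R.eval r a = \<one>\<^bsub>R\<^esub>"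
          "S.eval (map h r) b = S.eval (map h p) b \<otimes>\<^bsub>S\<^esub> S.eval (map h q) b"
          using pair_eval(2)[OF Kr h a b(1) p coeffs[OF q(1)]] one by auto
        have r0: "S.eval (map h r) b = \<zero>\<^bsub>S\<^esub>"
          using r(3) z S.eval_in_carrier[OF hS[OF coeffs[OF q(1)]] b(1)] by simp
        have m1: "set [\<ominus>\<^bsub>R\<^esub> \<one>\<^bsub>R\<^esub>] \<subseteq> ?K" using partial_isoD(3)[OF G] by force
        have hm1: "h (\<ominus>\<^bsub>R\<^esub> \<one>\<^bsub>R\<^esub>) = \<ominus>\<^bsub>S\<^esub> \<one>\<^bsub>S\<^esub>" using graph[OF partial_isoD(3)[OF G]] by simp
        \<comment> \<open>Subtracting 1 gives a polynomial vanishing at \<open>a\<close> whose value at \<open>b\<close> is \<open>-1\<close>, against \<open>root\<close>.\<close>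
        obtain s where s: "set s \<subseteq> ?K" "R.eval s a = \<zero>\<^bsub>R\<^esub>" "S.eval (map h s) b = \<ominus>\<^bsub>S\<^esub> \<one>\<^bsub>S\<^esub>"
          using pair_eval(1)[OF Kr h a b(1) r(1) m1] r(2) r0 a b(1) hm1 by (auto simp: R.r_neg)
        have "\<ominus>\<^bsub>S\<^esub> \<one>\<^bsub>S\<^esub> = \<zero>\<^bsub>S\<^esub>" using root[OF s(1,2)] s(3) by simp
        thus False by (metis S.add.inv_eq_1_iff S.one_closed S.zero_not_one)
      qed
    qed
  qed
  thus ?thesis by blast
qed

end

section \<open>The Steinitz isomorphism theorem\<close>

context field_pair
begin

text \<open>
  The subring of the product of the two fields that is generated by a set of pairs.
\<close>

inductive_set gen_pairs :: "('a \<times> 'c) set \<Rightarrow> ('a \<times> 'c) set" for A where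
  gen_minus_one: "(\<ominus>\<^bsub>R\<^esub> \<one>\<^bsub>R\<^esub>, \<ominus>\<^bsub>S\<^esub> \<one>\<^bsub>S\<^esub>) \<in> gen_pairs A"
| gen_incl: "z \<in> A \<Longrightarrow> z \<in> gen_pairs A"
| gen_add: "(x, y) \<in> gen_pairs A \<Longrightarrow> (x', y') \<in> gen_pairs A \<Longrightarrow> (x \<oplus>\<^bsub>R\<^esub> x', y \<oplus>\<^bsub>S\<^esub> y') \<in> gen_pairs A"
| gen_mult: "(x, y) \<in> gen_pairs A \<Longrightarrow> (x', y') \<in> gen_pairs A \<Longrightarrow> (x \<otimes>\<^bsub>R\<^esub> x', y \<otimes>\<^bsub>S\<^esub> y') \<in> gen_pairs A"

lemma gen_pairs_mono:
  assumes "A \<subseteq> B" shows "gen_pairs A \<subseteq> gen_pairs B"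
proof
  fix z assume "z \<in> gen_pairs A"
  thus "z \<in> gen_pairs B" by induction (use assms in \<open>auto intro: gen_pairs.intros\<close>)
qed

lemma gen_pairs_finitary:
  "z \<in> gen_pairs A \<Longrightarrow> \<exists>F. finite F \<and> F \<subseteq> A \<and> z \<in> gen_pairs F"
proof (induction rule: gen_pairs.induct)
  case gen_minus_one
  then show ?case by (auto intro: gen_pairs.gen_minus_one)
next
  case (gen_incl z)
  then show ?case by (intro exI[of _ "{z}"]) (auto intro: gen_pairs.gen_incl)
next
  case (gen_add x y x' y')
  then obtain F F' where F: "finite F" "F \<subseteq> A" "(x, y) \<in> gen_pairs F"
    "finite F'" "F' \<subseteq> A" "(x', y') \<in> gen_pairs F'" by blast
  then show ?case
    using gen_pairs_mono[of F "F \<union> F'"] gen_pairs_mono[of F' "F \<union> F'"]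
    by (intro exI[of _ "F \<union> F'"]) (auto intro!: gen_pairs.gen_add)
next
  case (gen_mult x y x' y')
  then obtain F F' where F: "finite F" "F \<subseteq> A" "(x, y) \<in> gen_pairs F"
    "finite F'" "F' \<subseteq> A" "(x', y') \<in> gen_pairs F'" by blast
  then show ?case
    using gen_pairs_mono[of F "F \<union> F'"] gen_pairs_mono[of F' "F \<union> F'"]
    by (intro exI[of _ "F \<union> F'"]) (auto intro!: gen_pairs.gen_mult)
qed

lemma gen_pairs_subset_partial_iso:
  assumes "partial_iso G" "A \<subseteq> G" shows "gen_pairs A \<subseteq> G"
proof
  fix z assume "z \<in> gen_pairs A"
  thus "z \<in> G" by induction (use assms partial_isoD(3-5)[OF assms(1)] in auto)
qed

lemma gen_pairs_in_generate_field:
  assumes "(x, y) \<in> gen_pairs A"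
  shows "x \<in> generate_field R (fst ` A)" "y \<in> generate_field S (snd ` A)"
proof -
  have "x \<in> generate_field R (fst ` A) \<and> y \<in> generate_field S (snd ` A)"
    using assms
  proof (induction "(x, y)" arbitrary: x y rule: gen_pairs.induct)
    case (gen_incl x y)
    hence "x \<in> fst ` A" "y \<in> snd ` A"
      using imageI[of "(x, y)" A fst] imageI[of "(x, y)" A snd] by simp_all
    thus ?case by (auto intro: generate_field.incl)
  qed (auto intro: generate_field.intros)
  thus "x \<in> generate_field R (fst ` A)" "y \<in> generate_field S (snd ` A)" by auto
qed

lemma partial_iso_gen_pairsI:
  assumes A: "A \<subseteq> carrier R \<times> carrier S"
    and z: "\<And>x y. (x, y) \<in> gen_pairs A \<Longrightarrow> x = \<zero>\<^bsub>R\<^esub> \<longleftrightarrow> y = \<zero>\<^bsub>S\<^esub>"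
  shows "partial_iso (gen_pairs A)"
proof -
  have "fst ` A \<subseteq> carrier R" "snd ` A \<subseteq> carrier S" using A by auto
  hence "x \<in> carrier R \<and> y \<in> carrier S" if "(x, y) \<in> gen_pairs A" for x y
    using R.generate_field_in_carrier[OF _ gen_pairs_in_generate_field(1)[OF that]]
      S.generate_field_in_carrier[OF _ gen_pairs_in_generate_field(2)[OF that]] by simp
  hence "gen_pairs A \<subseteq> carrier R \<times> carrier S" by auto
  thus ?thesis using z by (auto simp: partial_iso_def intro: gen_pairs.intros)
qed

lemma gen_pairs_empty:
  assumes "(x, y) \<in> gen_pairs {}"
  shows "\<exists>k::int. x = [k] \<cdot>\<^bsub>R\<^esub> \<one>\<^bsub>R\<^esub> \<and> y = [k] \<cdot>\<^bsub>S\<^esub> \<one>\<^bsub>S\<^esub>"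
  using assms
proof (induction "(x, y)" arbitrary: x y rule: gen_pairs.induct)
  case gen_minus_one
  have "\<ominus>\<^bsub>R\<^esub> \<one>\<^bsub>R\<^esub> = [(-1::int)] \<cdot>\<^bsub>R\<^esub> \<one>\<^bsub>R\<^esub>" "\<ominus>\<^bsub>S\<^esub> \<one>\<^bsub>S\<^esub> = [(-1::int)] \<cdot>\<^bsub>S\<^esub> \<one>\<^bsub>S\<^esub>"
    by (simp_all add: R.add.int_pow_neg S.add.int_pow_neg)
  then show ?case by blast
next
  case (gen_add x y x' y')
  then obtain k k' :: int where "x = [k] \<cdot>\<^bsub>R\<^esub> \<one>\<^bsub>R\<^esub>" "y = [k] \<cdot>\<^bsub>S\<^esub> \<one>\<^bsub>S\<^esub>"
    "x' = [k'] \<cdot>\<^bsub>R\<^esub> \<one>\<^bsub>R\<^esub>" "y' = [k'] \<cdot>\<^bsub>S\<^esub> \<one>\<^bsub>S\<^esub>" by blast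
  then show ?case
    by (intro exI[of _ "k + k'"]) (simp add: R.add.int_pow_mult S.add.int_pow_mult)
next
  case (gen_mult x y x' y')
  then obtain k k' :: int where "x = [k] \<cdot>\<^bsub>R\<^esub> \<one>\<^bsub>R\<^esub>" "y = [k] \<cdot>\<^bsub>S\<^esub> \<one>\<^bsub>S\<^esub>"
    "x' = [k'] \<cdot>\<^bsub>R\<^esub> \<one>\<^bsub>R\<^esub>" "y' = [k'] \<cdot>\<^bsub>S\<^esub> \<one>\<^bsub>S\<^esub>" by blast
  then show ?case
    by (intro exI[of _ "k' * k"])
      (simp add: R.add_pow_ldistr_int S.add_pow_ldistr_int R.add.int_pow_pow S.add.int_pow_pow)
qed simp

lemma partial_iso_prime_ring:
  assumes char: "\<And>n::nat. [n] \<cdot>\<^bsub>R\<^esub> \<one>\<^bsub>R\<^esub> = \<zero>\<^bsub>R\<^esub> \<longleftrightarrow> [n] \<cdot>\<^bsub>S\<^esub> \<one>\<^bsub>S\<^esub> = \<zero>\<^bsub>S\<^esub>"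
  shows "partial_iso (gen_pairs {})"
proof (rule partial_iso_gen_pairsI)
  fix x y assume "(x, y) \<in> gen_pairs {}"
  then obtain k :: int where k: "x = [k] \<cdot>\<^bsub>R\<^esub> \<one>\<^bsub>R\<^esub>" "y = [k] \<cdot>\<^bsub>S\<^esub> \<one>\<^bsub>S\<^esub>"
    using gen_pairs_empty by blast
  show "x = \<zero>\<^bsub>R\<^esub> \<longleftrightarrow> y = \<zero>\<^bsub>S\<^esub>"
  proof (cases "k \<ge> 0")
    case True
    thus ?thesis using char[of "nat k"] by (simp add: k add_pow_int_ge)
  next
    case False
    thus ?thesis using char[of "nat (- k)"]
      by (simp add: k add_pow_int_lt R.add.inv_eq_1_iff S.add.inv_eq_1_iff)
  qed
qed simp

text \<open>
  Adjoining the elements of a finite independent set one by one, each is transcendental over the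
  field generated by its predecessors, and so is its image.
\<close>

lemma partial_iso_finite_independent:
  assumes prime: "partial_iso (gen_pairs {})"
    and BR: "R.alg_independent B" and BS: "S.alg_independent (f ` B)" and inj: "inj_on f B"
    and F: "finite F" "F \<subseteq> B"
  shows "partial_iso (gen_pairs ((\<lambda>x. (x, f x)) ` F))"
  using F
proof (induction F rule: finite_induct)
  case empty
  then show ?case using prime by simp
next
  case (insert a F)
  let ?g = "\<lambda>x. (x, f x)"
  let ?G = "gen_pairs (?g ` F)"
  have G: "partial_iso ?G" using insert by blast
  have BRc: "B \<subseteq> carrier R" and BSc: "f ` B \<subseteq> carrier S"
    using BR BS by (auto simp: R.alg_independent_def S.alg_independent_def)
  have a: "a \<in> carrier R" "f a \<in> carrier S" using insert.prems BRc BSc by auto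
  have "F \<subseteq> B - {a}" using insert by auto
  hence "a \<notin> R.acl F"
    using BR insert.prems R.acl_mono[of F "B - {a}"] by (auto simp: R.alg_independent_def)
  hence ta: "(R.transcendental over (generate_field R F)) a"
    using a(1) by (auto simp: R.acl_def over_def)
  have "f ` F \<subseteq> f ` B - {f a}" using insert inj by (auto simp: inj_on_def)
  hence "f a \<notin> S.acl (f ` F)"
    using BS insert.prems S.acl_mono[of "f ` F" "f ` B - {f a}"] by (auto simp: S.alg_independent_def)
  hence tb: "(S.transcendental over (generate_field S (f ` F))) (f a)"
    using a(2) by (auto simp: S.acl_def over_def)
  have fst_F: "fst ` ?g ` F = F" and snd_F: "snd ` ?g ` F = f ` F" by (simp_all add: image_image)
  have "fst ` ?G \<subseteq> generate_field R F"
    using gen_pairs_in_generate_field(1)[of _ _ "?g ` F"] unfolding fst_F by auto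
  moreover have "snd ` ?G \<subseteq> generate_field S (f ` F)"
    using gen_pairs_in_generate_field(2)[of _ _ "?g ` F"] unfolding snd_F by auto
  ultimately obtain G' where G': "partial_iso G'" "?G \<subseteq> G'" "(a, f a) \<in> G'"
    using partial_iso_extend_transcendental[OF G a R.transcendental_mono[OF _ ta] S.transcendental_mono[OF _ tb]]
    by blast
  have sub: "gen_pairs (?g ` insert a F) \<subseteq> G'"
    using G' gen_incl[of _ "?g ` F"] by (intro gen_pairs_subset_partial_iso) auto
  show ?case
  proof (rule partial_iso_gen_pairsI)
    show "?g ` insert a F \<subseteq> carrier R \<times> carrier S" using insert.prems BRc BSc by auto
    fix x y assume "(x, y) \<in> gen_pairs (?g ` insert a F)"
    thus "x = \<zero>\<^bsub>R\<^esub> \<longleftrightarrow> y = \<zero>\<^bsub>S\<^esub>" using partial_isoD(6)[OF G'(1)] sub by blast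
  qed
qed

lemma partial_iso_independent:
  assumes prime: "partial_iso (gen_pairs {})"
    and BR: "R.alg_independent B" and BS: "S.alg_independent (f ` B)" and inj: "inj_on f B"
  shows "partial_iso (gen_pairs ((\<lambda>x. (x, f x)) ` B))"
proof (rule partial_iso_gen_pairsI)
  show "(\<lambda>x. (x, f x)) ` B \<subseteq> carrier R \<times> carrier S"
    using BR BS by (auto simp: R.alg_independent_def S.alg_independent_def)
  fix x y assume "(x, y) \<in> gen_pairs ((\<lambda>x. (x, f x)) ` B)"
  then obtain A where A: "finite A" "A \<subseteq> (\<lambda>x. (x, f x)) ` B" "(x, y) \<in> gen_pairs A"
    using gen_pairs_finitary by blast
  then obtain F where F: "F \<subseteq> B" "finite F" "A = (\<lambda>x. (x, f x)) ` F"
    using finite_subset_image[OF A(1,2)] by blast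
  show "x = \<zero>\<^bsub>R\<^esub> \<longleftrightarrow> y = \<zero>\<^bsub>S\<^esub>"
    using partial_isoD(6)[OF partial_iso_finite_independent[OF prime BR BS inj F(2,1)]] A(3) F(3) by blast
qed

lemma exists_maximal_partial_iso:
  assumes "partial_iso G"
  shows "\<exists>M. partial_iso M \<and> G \<subseteq> M \<and> (\<forall>G'. partial_iso G' \<longrightarrow> M \<subseteq> G' \<longrightarrow> G' = M)"
proof -
  let ?P = "{H. partial_iso H \<and> G \<subseteq> H}"
  have "\<exists>M\<in>?P. \<forall>H\<in>?P. M \<subseteq> H \<longrightarrow> H = M"
  proof (rule subset_Zorn_nonempty)
    show "?P \<noteq> {}" using assms by blast
    fix C assume ne: "C \<noteq> {}" and C: "subset.chain ?P C"
    have P: "partial_iso H" "G \<subseteq> H" if "H \<in> C" for H using C that by (auto simp: subset.chain_def)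
    have two: "\<exists>H\<in>C. z \<in> H \<and> z' \<in> H" if z: "z \<in> \<Union>C" "z' \<in> \<Union>C" for z z'
    proof -
      obtain H H' where H: "H \<in> C" "z \<in> H" "H' \<in> C" "z' \<in> H'" using z by blast
      hence "H \<subseteq> H' \<or> H' \<subseteq> H" using subset.chain_total[OF C] by blast
      thus ?thesis using H by blast
    qed
    have "partial_iso (\<Union>C)"
      unfolding partial_iso_def
    proof (intro conjI allI impI)
      show "\<Union>C \<subseteq> carrier R \<times> carrier S" using P(1) unfolding partial_iso_def by blast
      show "(\<ominus>\<^bsub>R\<^esub> \<one>\<^bsub>R\<^esub>, \<ominus>\<^bsub>S\<^esub> \<one>\<^bsub>S\<^esub>) \<in> \<Union>C" using ne P(1) partial_isoD(3) by blast
    next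
      fix x y x' y' assume "(x, y) \<in> \<Union>C" "(x', y') \<in> \<Union>C"
      then obtain H where H: "H \<in> C" "(x, y) \<in> H" "(x', y') \<in> H" using two by blast
      show "(x \<oplus>\<^bsub>R\<^esub> x', y \<oplus>\<^bsub>S\<^esub> y') \<in> \<Union>C"
        using partial_isoD(4)[OF P(1)[OF H(1)] H(2,3)] H(1) by blast
      show "(x \<otimes>\<^bsub>R\<^esub> x', y \<otimes>\<^bsub>S\<^esub> y') \<in> \<Union>C"
        using partial_isoD(5)[OF P(1)[OF H(1)] H(2,3)] H(1) by blast
    next
      fix x y assume "(x, y) \<in> \<Union>C"
      then obtain H where "H \<in> C" "(x, y) \<in> H" by blast
      thus "x = \<zero>\<^bsub>R\<^esub> \<longleftrightarrow> y = \<zero>\<^bsub>S\<^esub>" using partial_isoD(6)[OF P(1)] by simp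
    qed
    thus "\<Union>C \<in> ?P" using ne P(2) by blast
  qed
  then obtain M where M: "M \<in> ?P" "\<forall>H\<in>?P. M \<subseteq> H \<longrightarrow> H = M" by (rule bexE)
  have "H = M" if "partial_iso H" "M \<subseteq> H" for H
    using M that by (metis (mono_tags, lifting) mem_Collect_eq order.trans)
  with M(1) show ?thesis by (intro exI[of _ M]) simp
qed

text \<open>
  By maximality the domain is closed under inverses, hence a subfield containing \<open>B\<close>. All elements
  of \<open>R\<close> are algebraic over it, so maximality puts them into the domain.
\<close>

lemma maximal_partial_iso_domain:
  assumes M: "partial_iso M" and max: "\<And>G. partial_iso G \<Longrightarrow> M \<subseteq> G \<Longrightarrow> G = M"
    and closed: "algebraically_closed S" and B: "B \<subseteq> fst ` M" "R.acl B = carrier R"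
  shows "fst ` M = carrier R"
proof -
  let ?K = "fst ` M"
  have dom: "x \<in> ?K" if "(x, y) \<in> M" for x y using imageI[OF that, of fst] by simp
  obtain h where K: "subring ?K R" and graph: "\<And>x. x \<in> ?K \<Longrightarrow> (x, h x) \<in> M"
    using partial_iso_homE[OF M] by metis
  have KR: "?K \<subseteq> carrier R" using subringE(1)[OF K] .
  have "subfield ?K R"
  proof (rule R.subfieldI'[OF K])
    fix x assume "x \<in> ?K - {\<zero>\<^bsub>R\<^esub>}"
    hence x: "(x, h x) \<in> M" "x \<noteq> \<zero>\<^bsub>R\<^esub>" using graph by auto
    obtain G where "partial_iso G" "M \<subseteq> G" "(inv\<^bsub>R\<^esub> x, inv\<^bsub>S\<^esub> (h x)) \<in> G"
      using partial_iso_extend_inverse[OF M x] by blast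
    hence "(inv\<^bsub>R\<^esub> x, inv\<^bsub>S\<^esub> (h x)) \<in> M" using max by blast
    thus "inv\<^bsub>R\<^esub> x \<in> ?K" by (rule dom)
  qed
  note Kf = this
  have gf: "generate_field R B \<subseteq> ?K"
    using R.generate_field_min_subfield1[OF _ Kf B(1)] B(1) KR by blast
  have "x \<in> ?K" if x: "x \<in> carrier R" for x
  proof -
    have "(R.algebraic over (generate_field R B)) x" using x B(2) by (auto simp: R.acl_def)
    hence "(R.algebraic over ?K) x" using R.algebraic_mono[OF gf] by blast
    then obtain G y where G: "partial_iso G" "M \<subseteq> G" "(x, y) \<in> G"
      using partial_iso_extend_algebraic[OF M Kf closed x] by blast
    hence "(x, y) \<in> M" using max by blast
    thus ?thesis by (rule dom)
  qed
  thus ?thesis using KR by blast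
qed

lemma partial_iso_converse:
  "field_pair.partial_iso S R (G\<inverse>) \<longleftrightarrow> partial_iso G"
proof -
  interpret SR: field_pair S R by unfold_locales
  show ?thesis
    unfolding partial_iso_def SR.partial_iso_def by (auto simp: subset_iff)
qed

end

text \<open>
  A maximal partial isomorphism containing the graph of a bijection between transcendence bases
  is defined everywhere, and its converse, which is also maximal, is defined everywhere too.
\<close>

theorem steinitz:
  fixes R :: "('a, 'm) ring_scheme" and S :: "('c, 'n) ring_scheme"
  assumes R: "algebraically_closed R" and S: "algebraically_closed S"
    and char: "\<And>n::nat. [n] \<cdot>\<^bsub>R\<^esub> \<one>\<^bsub>R\<^esub> = \<zero>\<^bsub>R\<^esub> \<longleftrightarrow> [n] \<cdot>\<^bsub>S\<^esub> \<one>\<^bsub>S\<^esub> = \<zero>\<^bsub>S\<^esub>"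
    and unc: "uncountable (carrier R)" and card: "eqpoll (carrier R) (carrier S)"
  shows "R \<simeq> S"
proof -
  interpret R: algebraically_closed R by fact
  interpret S: algebraically_closed S by fact
  interpret RS: field_pair R S by unfold_locales
  interpret SR: field_pair S R by unfold_locales
  have unc': "uncountable (carrier S)" using unc card countable_eqpoll by blast
  obtain B where B: "R.alg_independent B" "R.acl B = carrier R" "eqpoll B (carrier R)"
    using R.exists_eqpoll_transcendence_basis[OF unc] by blast
  obtain C where C: "S.alg_independent C" "S.acl C = carrier S" "eqpoll C (carrier S)"
    using S.exists_eqpoll_transcendence_basis[OF unc'] by blast
  have "eqpoll B C" using B(3) C(3) card by (meson eqpoll_sym eqpoll_trans)
  then obtain f where f: "inj_on f B" "f ` B = C" by (auto simp: eqpoll_def bij_betw_def)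
  let ?G = "RS.gen_pairs ((\<lambda>x. (x, f x)) ` B)"
  have "RS.partial_iso ?G"
    using RS.partial_iso_independent[OF RS.partial_iso_prime_ring[OF char] B(1) _ f(1)] C(1) f(2) by simp
  then obtain M where M: "RS.partial_iso M" "?G \<subseteq> M" and max: "\<And>G. RS.partial_iso G \<Longrightarrow> M \<subseteq> G \<Longrightarrow> G = M"
    using RS.exists_maximal_partial_iso by blast
  have graph: "(\<lambda>x. (x, f x)) ` B \<subseteq> M" using M(2) RS.gen_incl by blast
  have "B \<subseteq> fst ` M" using image_mono[OF graph, of fst] by (simp add: image_image)
  hence dom: "fst ` M = carrier R"
    using RS.maximal_partial_iso_domain[OF M(1) max S _ B(2)] by blast
  have conv: "SR.partial_iso (M\<inverse>)" using RS.partial_iso_converse M(1) by blast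
  have max': "G = M\<inverse>" if "SR.partial_iso G" "M\<inverse> \<subseteq> G" for G
  proof -
    have "RS.partial_iso (G\<inverse>)" using that(1) SR.partial_iso_converse by blast
    moreover have "M \<subseteq> G\<inverse>" using that(2) by auto
    ultimately have "G\<inverse> = M" using max by blast
    thus ?thesis by auto
  qed
  have fst_conv: "fst ` (M\<inverse>) = snd ` M" by (simp flip: Domain_fst Range_snd)
  have "C \<subseteq> fst ` (M\<inverse>)" using image_mono[OF graph, of snd] f(2) fst_conv by (simp add: image_image)
  hence ran: "snd ` M = carrier S"
    using SR.maximal_partial_iso_domain[OF conv max' R _ C(2)] fst_conv by blast
  show ?thesis
  proof (rule RS.partial_iso_homE[OF M(1)])
    fix h assume h: "h \<in> ring_hom (R\<lparr>carrier := fst ` M\<rparr>) S"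
      and hM: "\<And>x. x \<in> fst ` M \<Longrightarrow> (x, h x) \<in> M" "\<And>x y. (x, y) \<in> M \<Longrightarrow> y = h x"
    have "h \<in> ring_hom R S" using h dom by (simp add: ring_hom_def)
    moreover have "inj_on h (carrier R)"
    proof (rule inj_onI)
      fix x y assume "x \<in> carrier R" "y \<in> carrier R" "h x = h y"
      hence "(h x, x) \<in> M\<inverse>" "(h x, y) \<in> M\<inverse>" using hM(1)[of x] hM(1)[of y] dom by auto
      thus "x = y" using SR.partial_iso_functional[OF conv] by blast
    qed
    moreover have "h ` carrier R = carrier S"
    proof -
      have "snd z = h (fst z)" if "z \<in> M" for z using hM(2)[of "fst z" "snd z"] that by simp
      hence "snd ` M = h ` fst ` M" by (simp add: image_image)
      thus ?thesis using dom ran by simp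
    qed
    ultimately have "h \<in> ring_iso R S" by (simp add: ring_iso_def bij_betw_def)
    thus ?thesis by (auto simp: is_ring_iso_def)
  qed
qed

section \<open>Complex polynomials with bounded roots\<close>

text \<open>
  The evaluation of coefficient lists with the leading coefficient first, for a ring given by a
  type class. It is the termwise counterpart of the evaluation of polynomials over the
  quotient field.
\<close>

primrec list_eval :: "'a::comm_ring_1 list \<Rightarrow> 'a \<Rightarrow> 'a" where
  "list_eval [] x = 0"
| "list_eval (a # p) x = a * x ^ length p + list_eval p x"

lemma list_eval_eq_poly: "list_eval p x = poly (Poly (rev p)) x"
  by (induction p) (auto simp: Poly_append poly_monom algebra_simps)

lemma list_eval_has_root:
  fixes c :: complex
  assumes "c \<noteq> 0" "cs \<noteq> []"
  shows "\<exists>z. list_eval (c # cs) z = 0"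
proof -
  let ?P = "Poly (rev (c # cs))"
  have "Polynomial.coeff ?P (length cs) = c"
    by (simp add: nth_default_append)
  hence "Polynomial.degree ?P \<ge> length cs"
    using assms by (intro le_degree) simp
  hence "Polynomial.degree ?P > 0" using assms(2) by (cases cs) auto
  then obtain z where "poly ?P z = 0" using alg_closed_imp_poly_has_root by blast
  thus ?thesis by (auto simp only: list_eval_eq_poly)
qed

lemma norm_list_eval_le:
  fixes z :: complex
  assumes "cmod z \<ge> 1" "cs \<noteq> []"
  shows "cmod (list_eval cs z) \<le> sum_list (map cmod cs) * cmod z ^ (length cs - 1)"
  using assms(2)
proof (induction cs)
  case (Cons c cs)
  show ?case
  proof (cases "cs = []")
    case False
    have "cmod (list_eval (c # cs) z) \<le> cmod (c * z ^ length cs) + cmod (list_eval cs z)"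
      by (simp add: norm_triangle_ineq)
    also have "\<dots> \<le> cmod c * cmod z ^ length cs + sum_list (map cmod cs) * cmod z ^ (length cs - 1)"
      using Cons.IH[OF False] by (simp add: norm_mult norm_power)
    also have "\<dots> \<le> cmod c * cmod z ^ length cs + sum_list (map cmod cs) * cmod z ^ length cs"
      using assms(1) by (intro add_left_mono mult_left_mono power_increasing) (auto intro!: sum_list_nonneg)
    finally show ?thesis by (simp add: algebra_simps)
  qed simp
qed simp

text \<open>
  The bound by the sum of the absolute values of the coefficients is what keeps a termwise choice
  of roots inside a solid ring of sequences.
\<close>

lemma monic_root_bound:
  fixes cs :: "complex list"
  assumes "cs \<noteq> []"
  shows "\<exists>z. list_eval (1 # cs) z = 0 \<and> cmod z \<le> 1 + sum_list (map cmod cs)"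
proof -
  obtain z where z: "list_eval (1 # cs) z = 0" using list_eval_has_root[of 1 cs] assms by auto
  have nonneg: "sum_list (map cmod cs) \<ge> 0" by (auto intro!: sum_list_nonneg)
  have "cmod z \<le> 1 + sum_list (map cmod cs)"
  proof (cases "cmod z \<ge> 1")
    case True
    obtain d where d: "length cs = Suc d" using assms by (cases cs) auto
    have "z ^ length cs = - list_eval cs z" using z by (simp add: eq_neg_iff_add_eq_0)
    hence "cmod z ^ Suc d = cmod (list_eval cs z)" using d by (metis norm_minus_cancel norm_power)
    hence "cmod z * cmod z ^ d \<le> sum_list (map cmod cs) * cmod z ^ d"
      using norm_list_eval_le[OF True assms] d by simp
    hence "cmod z \<le> sum_list (map cmod cs)"
      using True by (subst (asm) mult_le_cancel_right_pos) (auto intro!: zero_less_power)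
    thus ?thesis by simp
  qed (use nonneg in simp)
  thus ?thesis using z by blast
qed

section \<open>Adjoining i to a quotient of a ring of real sequences\<close>

lemma (in cring) complex_mult:
  assumes "a \<in> carrier R" "b \<in> carrier R" "c \<in> carrier R" "d \<in> carrier R" "j \<in> carrier R"
    and j: "j \<otimes> j \<oplus> \<one> = \<zero>"
  shows "(a \<oplus> b \<otimes> j) \<otimes> (c \<oplus> d \<otimes> j) = (a \<otimes> c \<oplus> \<ominus> (b \<otimes> d)) \<oplus> (a \<otimes> d \<oplus> b \<otimes> c) \<otimes> j"
proof -
  have jj: "j \<otimes> j = \<ominus> \<one>" using j assms by (metis m_closed minus_equality one_closed minus_minus a_comm a_inv_closed)
  have "(b \<otimes> j) \<otimes> (d \<otimes> j) = (b \<otimes> d) \<otimes> (j \<otimes> j)" using assms(1-5) by (simp add: m_ac)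
  also have "\<dots> = \<ominus> (b \<otimes> d)" unfolding jj using assms(1-5) by (simp add: r_minus)
  finally have bd: "(b \<otimes> j) \<otimes> (d \<otimes> j) = \<ominus> (b \<otimes> d)" .
  have "(a \<oplus> b \<otimes> j) \<otimes> (c \<oplus> d \<otimes> j)
      = a \<otimes> c \<oplus> (b \<otimes> j) \<otimes> (d \<otimes> j) \<oplus> (a \<otimes> (d \<otimes> j) \<oplus> (b \<otimes> j) \<otimes> c)"
    using assms(1-5) by (simp add: l_distr r_distr a_ac)
  also have "a \<otimes> (d \<otimes> j) \<oplus> (b \<otimes> j) \<otimes> c = (a \<otimes> d \<oplus> b \<otimes> c) \<otimes> j"
    using assms(1-5) by (simp add: l_distr r_distr m_ac)
  finally show ?thesis unfolding bd .
qed

text \<open>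
  The elements of \<open>R[x] / (x\<^sup>2 + 1)\<close> are represented by the remainders of degree at most one, which
  gives them the form \<open>u + v j\<close> with \<open>j\<close> the class of \<open>x\<close>.
\<close>

lemma (in field) adjoin_i_structure:
  fixes A
  defines "A \<equiv> Rupt\<^bsub>R\<^esub> (carrier R) [\<one>, \<zero>, \<one>]"
  shows "cring A" "\<one>\<^bsub>A\<^esub> \<noteq> \<zero>\<^bsub>A\<^esub>"
    "\<exists>h j. h \<in> ring_hom R A \<and> j \<in> carrier A \<and> j \<otimes>\<^bsub>A\<^esub> j \<oplus>\<^bsub>A\<^esub> \<one>\<^bsub>A\<^esub> = \<zero>\<^bsub>A\<^esub> \<and>
       (\<forall>z\<in>carrier A. \<exists>u\<in>carrier R. \<exists>v\<in>carrier R. z = h u \<oplus>\<^bsub>A\<^esub> h v \<otimes>\<^bsub>A\<^esub> j)"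
proof -
  let ?P = "[\<one>, \<zero>, \<one>]"
  let ?\<pi> = "rupture_surj (carrier R) ?P"
  have P: "?P \<in> carrier (poly_ring R)" by (simp add: univ_poly_def polynomial_def)
  interpret U: cring "poly_ring R" using univ_poly_is_cring[OF carrier_is_subring] .
  show A: "cring A"
    unfolding A_def rupture_def
    using ideal.quotient_is_cring[OF U.cgenideal_ideal[OF P] U.cring_axioms] .
  show "\<one>\<^bsub>A\<^esub> \<noteq> \<zero>\<^bsub>A\<^esub>"
    unfolding A_def by (rule rupture_one_not_zero[OF carrier_is_subfield P]) simp
  interpret A: cring A by fact
  interpret \<pi>: ring_hom_ring "poly_ring R" A ?\<pi>
    unfolding A_def using rupture_surj_hom(2)[OF carrier_is_subring P] .
  define h where "h = ?\<pi> \<circ> poly_of_const"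
  define j where "j = ?\<pi> (var R)"
  have V: "var R \<in> carrier (poly_ring R)" using var_closed(1)[OF carrier_is_subring] .
  have h: "h \<in> ring_hom R A"
    using rupture_surj_norm_is_hom[OF carrier_is_subring P] by (simp add: h_def A_def)
  have j: "j \<in> carrier A" using V by (simp add: j_def)
  have h0: "h \<zero> = \<zero>\<^bsub>A\<^esub>" "h \<one> = \<one>\<^bsub>A\<^esub>"
    using ring_hom_zero[OF h ring_axioms A.ring_axioms] ring_hom_one[OF h] by auto
  have "A.eval (map h ?P) j = \<zero>\<^bsub>A\<^esub>"
    using polynomial_rupture[OF carrier_is_subring P] by (simp add: h_def j_def A_def)
  hence jj: "j \<otimes>\<^bsub>A\<^esub> j \<oplus>\<^bsub>A\<^esub> \<one>\<^bsub>A\<^esub> = \<zero>\<^bsub>A\<^esub>"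
    using j by (simp add: h0 numeral_2_eq_2)
  have "\<exists>u\<in>carrier R. \<exists>v\<in>carrier R. z = h u \<oplus>\<^bsub>A\<^esub> h v \<otimes>\<^bsub>A\<^esub> j" if z: "z \<in> carrier A" for z
  proof -
    have "z \<in> ?\<pi> ` ((\<lambda>q. q pmod ?P) ` carrier (poly_ring R))"
      using rupture_carrier_as_pmod_image[OF carrier_is_subfield P] z unfolding A_def by simp
    then obtain q where q: "q \<in> carrier (poly_ring R)" "length q \<le> 2" "z = ?\<pi> q"
      using pmod_image_characterization[OF carrier_is_subfield P] by auto
    consider "q = []" | u where "q = [u]" | v u where "q = [v, u]"
      using q(2) by (cases q rule: list.exhaust; cases "tl q") (auto simp: Suc_le_eq)
    thus ?thesis
    proof cases
      case 1
      hence "z = \<zero>\<^bsub>A\<^esub>" using q(3) \<pi>.hom_zero by (simp add: univ_poly_zero)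
      thus ?thesis using j by (intro bexI[of _ \<zero>]) (auto simp: h0)
    next
      case 2
      hence u: "u \<in> carrier R" "u \<noteq> \<zero>" using q(1) by (auto simp: univ_poly_def polynomial_def)
      hence "z = h u" using 2 q(3) by (simp add: h_def poly_of_const_def)
      thus ?thesis using j u ring_hom_closed[OF h u(1)] by (intro bexI[of _ u] bexI[of _ \<zero>]) (auto simp: h0)
    next
      case 3
      hence u: "u \<in> carrier R" "v \<in> carrier R" "v \<noteq> \<zero>" using q(1) by (auto simp: univ_poly_def polynomial_def)
      have c: "poly_of_const u \<in> carrier (poly_ring R)" "poly_of_const v \<in> carrier (poly_ring R)"
        using u by (auto simp: poly_of_const_def univ_poly_def polynomial_def)
      have "q = poly_of_const u \<oplus>\<^bsub>poly_ring R\<^esub> poly_of_const v \<otimes>\<^bsub>poly_ring R\<^esub> var R"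
        using u by (simp add: 3 univ_poly_add univ_poly_mult poly_of_const_def var_def numeral_2_eq_2)
      hence "z = h u \<oplus>\<^bsub>A\<^esub> h v \<otimes>\<^bsub>A\<^esub> j"
        using c V by (simp add: q(3) h_def j_def)
      thus ?thesis using u by blast
    qed
  qed
  thus "\<exists>h j. h \<in> ring_hom R A \<and> j \<in> carrier A \<and> j \<otimes>\<^bsub>A\<^esub> j \<oplus>\<^bsub>A\<^esub> \<one>\<^bsub>A\<^esub> = \<zero>\<^bsub>A\<^esub> \<and>
       (\<forall>z\<in>carrier A. \<exists>u\<in>carrier R. \<exists>v\<in>carrier R. z = h u \<oplus>\<^bsub>A\<^esub> h v \<otimes>\<^bsub>A\<^esub> j)"
    using h j jj by blast
qed

text \<open>
  A sequence of complex numbers is coded by a set of natural numbers: its real and imaginary parts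
  are coded by sets of natural numbers, and these are merged into a single set.
\<close>

lemma sequences_lepoll_complex: "(UNIV :: (nat \<Rightarrow> complex) set) \<lesssim> (UNIV :: complex set)"
proof -
  have "(UNIV :: real set) \<lesssim> (UNIV :: nat set set)"
    using nat_sets_eqpoll_reals by (simp add: eqpoll_imp_lepoll eqpoll_sym)
  then obtain g :: "real \<Rightarrow> nat set" where g: "inj g" by (auto simp: lepoll_def)
  \<comment> \<open>The flag \<open>b\<close> distinguishes the real from the imaginary part of the \<open>n\<close>-th term.\<close>
  define G where "G = (\<lambda>f :: nat \<Rightarrow> complex.
    to_nat ` {(n :: nat, b :: bool, m :: nat). m \<in> g (if b then Re (f n) else Im (f n))})"
  have "inj G"
  proof (rule injI)
    fix f f' assume "G f = G f'"
    hence eq: "{(n :: nat, b :: bool, m :: nat). m \<in> g (if b then Re (f n) else Im (f n))}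
      = {(n, b, m). m \<in> g (if b then Re (f' n) else Im (f' n))}"
      unfolding G_def by (simp add: inj_image_eq_iff)
    have "g (if b then Re (f n) else Im (f n)) = g (if b then Re (f' n) else Im (f' n))" for n b
      using eq by (auto simp: set_eq_iff)
    hence *: "(if b then Re (f n) else Im (f n)) = (if b then Re (f' n) else Im (f' n))" for n b
      using g by (simp add: inj_eq)
    show "f = f'" using *[of True] *[of False] by (auto simp: complex_eq_iff)
  qed
  hence "(UNIV :: (nat \<Rightarrow> complex) set) \<lesssim> (UNIV :: nat set set)" by (auto simp: lepoll_def)
  also have "(UNIV :: nat set set) \<lesssim> (UNIV :: real set)"
    using nat_sets_eqpoll_reals by (simp add: eqpoll_imp_lepoll)
  also have "(UNIV :: real set) \<lesssim> (UNIV :: complex set)"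
    unfolding lepoll_def by (intro exI[of _ complex_of_real]) (auto simp: inj_def)
  finally show ?thesis .
qed

text \<open>
  A field that is the image of a ring of real sequences under a ring homomorphism \<open>\<phi>\<close>. Solidity of
  \<open>T\<close> makes termwise constructions available whenever they can be bounded: the inverse of a complex
  number, and the roots of a complex polynomial.
\<close>

locale solid_quotient = field R for R :: "'a ring" (structure) +
  fixes T :: "(nat \<Rightarrow> real) set" and \<phi> :: "(nat \<Rightarrow> real) \<Rightarrow> 'a"
  assumes T_const: "(\<lambda>_. c) \<in> T"
    and T_add: "f \<in> T \<Longrightarrow> g \<in> T \<Longrightarrow> (\<lambda>n. f n + g n) \<in> T"
    and T_mult: "f \<in> T \<Longrightarrow> g \<in> T \<Longrightarrow> (\<lambda>n. f n * g n) \<in> T"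
    and T_solid: "f \<in> T \<Longrightarrow> (\<And>n. \<bar>g n\<bar> \<le> \<bar>f n\<bar>) \<Longrightarrow> g \<in> T"
    and phi_surj: "\<phi> ` T = carrier R"
    and phi_add: "f \<in> T \<Longrightarrow> g \<in> T \<Longrightarrow> \<phi> (\<lambda>n. f n + g n) = \<phi> f \<oplus> \<phi> g"
    and phi_mult: "f \<in> T \<Longrightarrow> g \<in> T \<Longrightarrow> \<phi> (\<lambda>n. f n * g n) = \<phi> f \<otimes> \<phi> g"
    and phi_one: "\<phi> (\<lambda>_. 1) = \<one>"
begin

lemma phi_closed [simp]: "f \<in> T \<Longrightarrow> \<phi> f \<in> carrier R"
  using phi_surj by blast

lemma phi_zero: "\<phi> (\<lambda>_. 0) = \<zero>"
proof -
  have "\<phi> (\<lambda>_. 0) \<oplus> \<phi> (\<lambda>_. 0) = \<phi> (\<lambda>_. 0)"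
    using phi_add[OF T_const[of 0] T_const[of 0]] by simp
  thus ?thesis using phi_closed[OF T_const[of 0]] by (metis add.r_cancel_one)
qed

lemma T_uminus: "f \<in> T \<Longrightarrow> (\<lambda>n. - f n) \<in> T"
  by (erule T_solid) simp

lemma phi_uminus:
  assumes "f \<in> T" shows "\<phi> (\<lambda>n. - f n) = \<ominus> \<phi> f"
proof -
  have "\<phi> (\<lambda>n. - f n) \<oplus> \<phi> f = \<zero>"
    using phi_add[OF T_uminus[OF assms] assms] phi_zero by simp
  thus ?thesis using assms T_uminus by (intro minus_equality[symmetric]) auto
qed

text \<open>
  The kernel of \<open>\<phi>\<close> is solid, because \<open>g = (g / f) f\<close> where \<open>g / f\<close> is bounded and so lies in \<open>T\<close>. The
  convention \<open>g / 0 = 0\<close> does no harm since \<open>g\<close> vanishes where \<open>f\<close> does.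
\<close>

lemma phi_zero_solid:
  assumes f: "f \<in> T" "\<phi> f = \<zero>" and g: "\<And>n. \<bar>g n\<bar> \<le> \<bar>f n\<bar>"
  shows "\<phi> g = \<zero>"
proof -
  define k where "k = (\<lambda>n. g n / f n)"
  have k1: "\<bar>k n\<bar> \<le> \<bar>1\<bar>" for n using g[of n] by (cases "f n = 0") (auto simp: k_def divide_le_eq_1)
  have k: "k \<in> T" using k1 by (rule T_solid[OF T_const])
  have "g = (\<lambda>n. k n * f n)"
  proof
    fix n show "g n = k n * f n" using g[of n] by (cases "f n = 0") (auto simp: k_def)
  qed
  hence "\<phi> g = \<phi> k \<otimes> \<phi> f" using phi_mult[OF k f(1)] by simp
  thus ?thesis using f(2) k by simp
qed

definition CT :: "(nat \<Rightarrow> complex) set" where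
  "CT = {f. (\<lambda>n. cmod (f n)) \<in> T}"

lemma CT_bound: 
  assumes "g \<in> T" "\<And>n. cmod (f n) \<le> g n" shows "f \<in> CT"
proof -
  have "\<bar>cmod (f n)\<bar> \<le> \<bar>g n\<bar>" for n using assms(2)[of n] norm_ge_zero[of "f n"] by linarith
  hence "(\<lambda>n. cmod (f n)) \<in> T" by (rule T_solid[OF assms(1)])
  thus ?thesis by (simp add: CT_def)
qed

lemma CT_const: "(\<lambda>_. c) \<in> CT"
  by (simp add: CT_def T_const)

lemma CT_add: "f \<in> CT \<Longrightarrow> g \<in> CT \<Longrightarrow> (\<lambda>n. f n + g n) \<in> CT"
  by (rule CT_bound[OF T_add[of "\<lambda>n. cmod (f n)" "\<lambda>n. cmod (g n)"]]) (auto simp: CT_def norm_triangle_ineq)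

lemma CT_mult: "f \<in> CT \<Longrightarrow> g \<in> CT \<Longrightarrow> (\<lambda>n. f n * g n) \<in> CT"
  by (rule CT_bound[OF T_mult[of "\<lambda>n. cmod (f n)" "\<lambda>n. cmod (g n)"]]) (auto simp: CT_def norm_mult)

lemma CT_power: "f \<in> CT \<Longrightarrow> (\<lambda>n. f n ^ k) \<in> CT"
  by (induction k) (auto intro: CT_const CT_mult)

lemma CT_Re: "f \<in> CT \<Longrightarrow> (\<lambda>n. Re (f n)) \<in> T" and CT_Im: "f \<in> CT \<Longrightarrow> (\<lambda>n. Im (f n)) \<in> T"
  unfolding CT_def by (auto elim!: T_solid simp: abs_Re_le_cmod abs_Im_le_cmod)

lemma CT_complex: "f \<in> T \<Longrightarrow> g \<in> T \<Longrightarrow> (\<lambda>n. Complex (f n) (g n)) \<in> CT"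
proof (rule CT_bound[of "\<lambda>n. \<bar>f n\<bar> + \<bar>g n\<bar>"])
  assume "f \<in> T" "g \<in> T"
  hence "(\<lambda>n. \<bar>f n\<bar>) \<in> T" "(\<lambda>n. \<bar>g n\<bar>) \<in> T" by (auto intro: T_solid[of f] T_solid[of g])
  thus "(\<lambda>n. \<bar>f n\<bar> + \<bar>g n\<bar>) \<in> T" by (rule T_add)
  show "cmod (Complex (f n) (g n)) \<le> \<bar>f n\<bar> + \<bar>g n\<bar>" for n
    using cmod_le[of "Complex (f n) (g n)"] by simp
qed

lemma CT_sum_norms: "set Fs \<subseteq> CT \<Longrightarrow> (\<lambda>n. sum_list (map (\<lambda>F. cmod (F n)) Fs)) \<in> T"
  by (induction Fs) (auto intro!: T_add T_const simp: CT_def)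

lemma CT_list_eval:
  "set Fs \<subseteq> CT \<Longrightarrow> z \<in> CT \<Longrightarrow> (\<lambda>n. list_eval (map (\<lambda>F. F n) Fs) (z n)) \<in> CT"
  by (induction Fs) (auto intro!: CT_add CT_mult CT_power CT_const)

text \<open>
  The description of a field as a quotient of the ring of complex sequences of \<open>CT\<close>, from
  which algebraic closedness, characteristic and cardinality are read off.
\<close>

definition complexification :: "('b, 'm) ring_scheme \<Rightarrow> ((nat \<Rightarrow> complex) \<Rightarrow> 'b) \<Rightarrow> bool" where
  "complexification A \<psi> \<longleftrightarrow> field A \<and> \<psi> ` CT = carrier A \<and> \<psi> (\<lambda>_. 1) = \<one>\<^bsub>A\<^esub> \<and>
     (\<forall>f\<in>CT. \<forall>g\<in>CT. \<psi> (\<lambda>n. f n + g n) = \<psi> f \<oplus>\<^bsub>A\<^esub> \<psi> g \<and> \<psi> (\<lambda>n. f n * g n) = \<psi> f \<otimes>\<^bsub>A\<^esub> \<psi> g)"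

text \<open>
  A sequence with real part \<open>f\<close> and imaginary part \<open>g\<close> is sent to \<open>\<phi> f + (\<phi> g) i\<close>. The inverse of
  a nonzero element is its conjugate divided by the norm \<open>N\<close>; here \<open>\<phi> N\<close> is nonzero since
  \<open>N\<close> dominates the squares of the real and the imaginary part, and the kernel of \<open>\<phi>\<close> is solid.
\<close>

lemma adjoin_i_complexification: "\<exists>\<psi>. complexification (adjoin_i R) \<psi>"
proof -
  define A where "A = Rupt\<^bsub>R\<^esub> (carrier R) [\<one>, \<zero>, \<one>]"
  interpret A: cring A unfolding A_def by (rule adjoin_i_structure(1))
  have A1: "\<one>\<^bsub>A\<^esub> \<noteq> \<zero>\<^bsub>A\<^esub>" unfolding A_def by (rule adjoin_i_structure(2))
  have "\<exists>h j. h \<in> ring_hom R A \<and> j \<in> carrier A \<and> j \<otimes>\<^bsub>A\<^esub> j \<oplus>\<^bsub>A\<^esub> \<one>\<^bsub>A\<^esub> = \<zero>\<^bsub>A\<^esub> \<and>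
      (\<forall>z\<in>carrier A. \<exists>u\<in>carrier R. \<exists>v\<in>carrier R. z = h u \<oplus>\<^bsub>A\<^esub> h v \<otimes>\<^bsub>A\<^esub> j)"
    unfolding A_def by (rule adjoin_i_structure(3))
  then obtain h j where hj: "h \<in> ring_hom R A \<and> j \<in> carrier A \<and> j \<otimes>\<^bsub>A\<^esub> j \<oplus>\<^bsub>A\<^esub> \<one>\<^bsub>A\<^esub> = \<zero>\<^bsub>A\<^esub> \<and>
      (\<forall>z\<in>carrier A. \<exists>u\<in>carrier R. \<exists>v\<in>carrier R. z = h u \<oplus>\<^bsub>A\<^esub> h v \<otimes>\<^bsub>A\<^esub> j)"
    by (elim exE)
  have h: "h \<in> ring_hom R A" and j: "j \<in> carrier A" "j \<otimes>\<^bsub>A\<^esub> j \<oplus>\<^bsub>A\<^esub> \<one>\<^bsub>A\<^esub> = \<zero>\<^bsub>A\<^esub>"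
    and gen: "\<And>z. z \<in> carrier A \<Longrightarrow> \<exists>u\<in>carrier R. \<exists>v\<in>carrier R. z = h u \<oplus>\<^bsub>A\<^esub> h v \<otimes>\<^bsub>A\<^esub> j"
    using hj by simp_all
  interpret h: ring_hom_ring R A h
    using h ring_axioms A.ring_axioms by (simp add: ring_hom_ring_def ring_hom_ring_axioms_def)
  define \<psi> where "\<psi> = (\<lambda>f. h (\<phi> (\<lambda>n. Re (f n))) \<oplus>\<^bsub>A\<^esub> h (\<phi> (\<lambda>n. Im (f n))) \<otimes>\<^bsub>A\<^esub> j)"
  have closed: "\<psi> f \<in> carrier A" if "f \<in> CT" for f
    using CT_Re[OF that] CT_Im[OF that] j(1) by (simp add: \<psi>_def)
  have add: "\<psi> (\<lambda>n. f n + g n) = \<psi> f \<oplus>\<^bsub>A\<^esub> \<psi> g" if f: "f \<in> CT" and g: "g \<in> CT" for f g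
  proof -
    note C = CT_Re[OF f] CT_Im[OF f] CT_Re[OF g] CT_Im[OF g]
    have "\<psi> (\<lambda>n. f n + g n) = (h (\<phi> (\<lambda>n. Re (f n))) \<oplus>\<^bsub>A\<^esub> h (\<phi> (\<lambda>n. Re (g n))))
        \<oplus>\<^bsub>A\<^esub> (h (\<phi> (\<lambda>n. Im (f n))) \<oplus>\<^bsub>A\<^esub> h (\<phi> (\<lambda>n. Im (g n)))) \<otimes>\<^bsub>A\<^esub> j"
      using C by (simp add: \<psi>_def phi_add)
    thus ?thesis using C j(1) by (simp add: \<psi>_def A.l_distr A.a_ac)
  qed
  have mult: "\<psi> (\<lambda>n. f n * g n) = \<psi> f \<otimes>\<^bsub>A\<^esub> \<psi> g" if f: "f \<in> CT" and g: "g \<in> CT" for f g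
  proof -
    note C = CT_Re[OF f] CT_Im[OF f] CT_Re[OF g] CT_Im[OF g]
    have "\<phi> (\<lambda>n. Re (f n * g n)) = \<phi> (\<lambda>n. Re (f n) * Re (g n) + - (Im (f n) * Im (g n)))"
      by simp
    also have "\<dots> = \<phi> (\<lambda>n. Re (f n)) \<otimes> \<phi> (\<lambda>n. Re (g n)) \<oplus> \<ominus> (\<phi> (\<lambda>n. Im (f n)) \<otimes> \<phi> (\<lambda>n. Im (g n)))"
      using phi_add[OF T_mult[OF C(1,3)] T_uminus[OF T_mult[OF C(2,4)]]]
        phi_uminus[OF T_mult[OF C(2,4)]] phi_mult[OF C(1,3)] phi_mult[OF C(2,4)] by simp
    finally have re: "\<phi> (\<lambda>n. Re (f n * g n)) =
        \<phi> (\<lambda>n. Re (f n)) \<otimes> \<phi> (\<lambda>n. Re (g n)) \<oplus> \<ominus> (\<phi> (\<lambda>n. Im (f n)) \<otimes> \<phi> (\<lambda>n. Im (g n)))" .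
    have im: "\<phi> (\<lambda>n. Im (f n * g n)) =
        \<phi> (\<lambda>n. Re (f n)) \<otimes> \<phi> (\<lambda>n. Im (g n)) \<oplus> \<phi> (\<lambda>n. Im (f n)) \<otimes> \<phi> (\<lambda>n. Re (g n))"
      using C by (simp add: phi_add phi_mult T_mult)
    have HC: "h (\<phi> (\<lambda>n. Re (f n))) \<in> carrier A" "h (\<phi> (\<lambda>n. Im (f n))) \<in> carrier A"
      "h (\<phi> (\<lambda>n. Re (g n))) \<in> carrier A" "h (\<phi> (\<lambda>n. Im (g n))) \<in> carrier A"
      using C by auto
    show ?thesis
      unfolding \<psi>_def A.complex_mult[OF HC j] re im using C by simp
  qed
  have one: "\<psi> (\<lambda>_. 1) = \<one>\<^bsub>A\<^esub>"
    using j(1) by (simp add: \<psi>_def phi_one phi_zero)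
  have surj: "\<psi> ` CT = carrier A"
  proof
    show "\<psi> ` CT \<subseteq> carrier A" using closed by blast
    show "carrier A \<subseteq> \<psi> ` CT"
    proof
      fix z assume "z \<in> carrier A"
      then obtain u v where uv: "u \<in> carrier R" "v \<in> carrier R" "z = h u \<oplus>\<^bsub>A\<^esub> h v \<otimes>\<^bsub>A\<^esub> j"
        using gen by blast
      then obtain f g where fg: "f \<in> T" "g \<in> T" "u = \<phi> f" "v = \<phi> g" using phi_surj by blast
      have "z = \<psi> (\<lambda>n. Complex (f n) (g n))" by (simp add: uv fg \<psi>_def)
      thus "z \<in> \<psi> ` CT" using CT_complex[OF fg(1,2)] by blast
    qed
  qed
  have "field A"
  proof (rule A.cring_fieldI2)
    show "\<zero>\<^bsub>A\<^esub> \<noteq> \<one>\<^bsub>A\<^esub>" using A1 by simp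
    fix z assume z: "z \<in> carrier A" "z \<noteq> \<zero>\<^bsub>A\<^esub>"
    then obtain f where f: "f \<in> CT" "z = \<psi> f" using surj by blast
    define N where "N = (\<lambda>n. (cmod (f n))\<^sup>2)"
    have NT: "N \<in> T" unfolding N_def power2_eq_square using f(1) by (intro T_mult) (auto simp: CT_def)
    have cf: "(\<lambda>n. cnj (f n)) \<in> CT" using f(1) by (simp add: CT_def)
    have "\<phi> N \<noteq> \<zero>"
    proof
      assume N0: "\<phi> N = \<zero>"
      have "\<phi> (\<lambda>n. Re (f n) * Re (f n)) = \<zero>" "\<phi> (\<lambda>n. Im (f n) * Im (f n)) = \<zero>"
        by (rule phi_zero_solid[OF NT N0]; simp add: N_def cmod_power2 flip: power2_eq_square)+
      hence "\<phi> (\<lambda>n. Re (f n)) = \<zero>" "\<phi> (\<lambda>n. Im (f n)) = \<zero>"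
        using CT_Re[OF f(1)] CT_Im[OF f(1)] by (auto simp: phi_mult dest: integral)
      hence "\<psi> f = \<zero>\<^bsub>A\<^esub>" using j(1) by (simp add: \<psi>_def)
      thus False using z(2) f(2) by simp
    qed
    hence inv: "inv (\<phi> N) \<in> carrier R" "\<phi> N \<otimes> inv (\<phi> N) = \<one>" using NT field_Units by auto
    have "f n * cnj (f n) = complex_of_real (N n)" for n
      by (simp only: N_def complex_norm_square)
    hence "\<psi> f \<otimes>\<^bsub>A\<^esub> \<psi> (\<lambda>n. cnj (f n)) = h (\<phi> N)"
      using mult[OF f(1) cf] NT j(1) by (simp add: \<psi>_def phi_zero)
    hence "\<psi> f \<otimes>\<^bsub>A\<^esub> \<psi> (\<lambda>n. cnj (f n)) \<otimes>\<^bsub>A\<^esub> h (inv (\<phi> N)) = h (\<phi> N \<otimes> inv (\<phi> N))"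
      using inv NT h.hom_mult[of "\<phi> N" "inv (\<phi> N)"] by simp
    hence "z \<otimes>\<^bsub>A\<^esub> (\<psi> (\<lambda>n. cnj (f n)) \<otimes>\<^bsub>A\<^esub> h (inv (\<phi> N))) = \<one>\<^bsub>A\<^esub>"
      using A.m_assoc[OF closed[OF f(1)] closed[OF cf] h.hom_closed[OF inv(1)]] f(2) inv(2) by simp
    thus "\<exists>w\<in>carrier A. z \<otimes>\<^bsub>A\<^esub> w = \<one>\<^bsub>A\<^esub>"
      using A.m_closed[OF closed[OF cf] h.hom_closed[OF inv(1)]] by (rule bexI)
  qed
  hence "complexification A \<psi>" using surj one add mult by (simp add: complexification_def)
  thus ?thesis unfolding A_def adjoin_i_def by blast
qed

context
  fixes A :: "('b, 'm) ring_scheme" and \<psi>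
  assumes psi: "complexification A \<psi>"
begin

interpretation A: field A using psi by (simp add: complexification_def)

lemma psi_closed: "f \<in> CT \<Longrightarrow> \<psi> f \<in> carrier A"
  and psi_surj: "\<psi> ` CT = carrier A"
  and psi_one: "\<psi> (\<lambda>_. 1) = \<one>\<^bsub>A\<^esub>"
  and psi_add: "f \<in> CT \<Longrightarrow> g \<in> CT \<Longrightarrow> \<psi> (\<lambda>n. f n + g n) = \<psi> f \<oplus>\<^bsub>A\<^esub> \<psi> g"
  and psi_mult: "f \<in> CT \<Longrightarrow> g \<in> CT \<Longrightarrow> \<psi> (\<lambda>n. f n * g n) = \<psi> f \<otimes>\<^bsub>A\<^esub> \<psi> g"
  using psi by (auto simp: complexification_def)

lemma psi_zero: "\<psi> (\<lambda>_. 0) = \<zero>\<^bsub>A\<^esub>"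
proof -
  have "\<psi> (\<lambda>_. 0) \<oplus>\<^bsub>A\<^esub> \<psi> (\<lambda>_. 0) = \<psi> (\<lambda>_. 0)"
    using psi_add[OF CT_const[of 0] CT_const[of 0]] by simp
  thus ?thesis using psi_closed[OF CT_const[of 0]] by (metis A.add.r_cancel_one)
qed

lemma psi_power: "f \<in> CT \<Longrightarrow> \<psi> (\<lambda>n. f n ^ k) = \<psi> f [^]\<^bsub>A\<^esub> k"
proof (induction k)
  case (Suc k)
  have "\<psi> (\<lambda>n. f n ^ Suc k) = \<psi> (\<lambda>n. f n ^ k * f n)" by (simp add: mult.commute)
  then show ?case using Suc CT_power[of f k] by (simp add: psi_mult)
qed (simp add: psi_one)

lemma psi_list_eval:
  "set Fs \<subseteq> CT \<Longrightarrow> z \<in> CT \<Longrightarrow>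
    A.eval (map \<psi> Fs) (\<psi> z) = \<psi> (\<lambda>n. list_eval (map (\<lambda>F. F n) Fs) (z n))"
  by (induction Fs) (simp_all add: psi_zero psi_add psi_mult psi_power CT_mult CT_power CT_list_eval)

lemma psi_const_nonzero:
  assumes "c \<noteq> 0" shows "\<psi> (\<lambda>_. c) \<noteq> \<zero>\<^bsub>A\<^esub>"
proof
  assume "\<psi> (\<lambda>_. c) = \<zero>\<^bsub>A\<^esub>"
  hence "\<psi> (\<lambda>_. c) \<otimes>\<^bsub>A\<^esub> \<psi> (\<lambda>_. inverse c) = \<zero>\<^bsub>A\<^esub>"
    using psi_closed[OF CT_const] by simp
  thus False using psi_mult[OF CT_const[of c] CT_const[of "inverse c"]] assms psi_one by simp
qed

lemma complexification_char_zero: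
  fixes n :: nat
  shows "[n] \<cdot>\<^bsub>A\<^esub> \<one>\<^bsub>A\<^esub> = \<zero>\<^bsub>A\<^esub> \<longleftrightarrow> n = 0"
proof -
  have "[n] \<cdot>\<^bsub>A\<^esub> \<one>\<^bsub>A\<^esub> = \<psi> (\<lambda>_. of_nat n)"
  proof (induction n)
    case 0
    then show ?case by (simp add: psi_zero)
  next
    case (Suc n)
    have "\<psi> (\<lambda>_. of_nat (Suc n)) = \<psi> (\<lambda>_. of_nat n + 1)" by (simp add: add.commute)
    thus ?case using Suc psi_add[OF CT_const CT_const] by (simp add: A.add.nat_pow_Suc psi_one)
  qed
  thus ?thesis using psi_const_nonzero[of "of_nat n"] psi_zero by auto
qed

lemma complexification_eqpoll: "(UNIV :: complex set) \<approx> carrier A"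
proof (rule lepoll_antisym)
  have "inj (\<lambda>c. \<psi> (\<lambda>_. c))"
  proof (rule injI, rule ccontr)
    fix c d assume eq: "\<psi> (\<lambda>_. c) = \<psi> (\<lambda>_. d)" and "c \<noteq> d"
    have "\<psi> (\<lambda>_. c) = \<psi> (\<lambda>_. c - d) \<oplus>\<^bsub>A\<^esub> \<psi> (\<lambda>_. d)"
      using psi_add[OF CT_const[of "c - d"] CT_const[of d]] by simp
    hence "\<psi> (\<lambda>_. c - d) = \<zero>\<^bsub>A\<^esub>"
      using eq psi_closed[OF CT_const] by (metis A.add.l_cancel_one' A.a_comm)
    thus False using psi_const_nonzero[of "c - d"] \<open>c \<noteq> d\<close> by simp
  qed
  thus "(UNIV :: complex set) \<lesssim> carrier A"
    unfolding lepoll_def by (intro exI[of _ "\<lambda>c. \<psi> (\<lambda>_. c)"]) (auto intro: psi_closed CT_const)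
  have "carrier A \<lesssim> CT" unfolding psi_surj[symmetric] by (rule image_lepoll)
  also have "CT \<lesssim> (UNIV :: (nat \<Rightarrow> complex) set)" by (rule subset_imp_lepoll) simp
  also note sequences_lepoll_complex
  finally show "carrier A \<lesssim> (UNIV :: complex set)" .
qed

text \<open>
  After division by its leading coefficient the polynomial has coefficients \<open>\<psi> F\<close> with sequences \<open>F\<close>
  in \<open>CT\<close>. The sequence \<open>z\<close> of roots chosen termwise is dominated by the coefficients, so it lies in
  \<open>CT\<close>, and \<open>\<psi> z\<close> is a root.
\<close>

lemma complexification_algebraically_closed: "algebraically_closed A"
proof (rule A.algebraically_closedI)
  fix p assume p: "p \<in> carrier (poly_ring A)" "length p - 1 > 1"
  obtain c cs where pc: "p = c # cs" using p(2) by (cases p) auto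
  have c: "c \<in> carrier A" "c \<noteq> \<zero>\<^bsub>A\<^esub>" "set cs \<subseteq> carrier A" "cs \<noteq> []"
    using p by (auto simp: pc univ_poly_def polynomial_def)
  have ic: "inv\<^bsub>A\<^esub> c \<in> carrier A" "c \<otimes>\<^bsub>A\<^esub> inv\<^bsub>A\<^esub> c = \<one>\<^bsub>A\<^esub>" using c A.field_Units by auto
  have "\<exists>Fs. set Fs \<subseteq> CT \<and> map \<psi> Fs = map (\<lambda>a. inv\<^bsub>A\<^esub> c \<otimes>\<^bsub>A\<^esub> a) cs"
    using c(3)
  proof (induction cs)
    case (Cons a cs)
    then obtain Fs where Fs: "set Fs \<subseteq> CT" "map \<psi> Fs = map (\<lambda>a. inv\<^bsub>A\<^esub> c \<otimes>\<^bsub>A\<^esub> a) cs" by auto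
    have "inv\<^bsub>A\<^esub> c \<otimes>\<^bsub>A\<^esub> a \<in> \<psi> ` CT" unfolding psi_surj using Cons.prems ic by simp
    then obtain F where "F \<in> CT" "\<psi> F = inv\<^bsub>A\<^esub> c \<otimes>\<^bsub>A\<^esub> a" by auto
    thus ?case using Fs by (intro exI[of _ "F # Fs"]) simp
  qed simp
  then obtain Fs where Fs: "set Fs \<subseteq> CT" "map \<psi> Fs = map (\<lambda>a. inv\<^bsub>A\<^esub> c \<otimes>\<^bsub>A\<^esub> a) cs" by blast
  have len: "length Fs = length cs" using Fs(2) by (metis length_map)
  hence ne: "Fs \<noteq> []" using c(4) by auto
  have "\<exists>w. list_eval (1 # map (\<lambda>F. F n) Fs) w = 0 \<and> cmod w \<le> 1 + sum_list (map (\<lambda>F. cmod (F n)) Fs)" for n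
    using monic_root_bound[of "map (\<lambda>F. F n) Fs"] ne by (simp add: comp_def)
  then obtain z where z: "\<And>n. list_eval (1 # map (\<lambda>F. F n) Fs) (z n) = 0"
    "\<And>n. cmod (z n) \<le> 1 + sum_list (map (\<lambda>F. cmod (F n)) Fs)" by metis
  have zT: "z \<in> CT"
    using z(2) by (intro CT_bound[OF T_add[OF T_const CT_sum_norms[OF Fs(1)]]])
  have zA: "\<psi> z \<in> carrier A" using psi_closed[OF zT] .
  let ?G = "(\<lambda>_. 1) # Fs"
  have G: "set ?G \<subseteq> CT" using Fs(1) CT_const by simp
  have "A.eval (map \<psi> ?G) (\<psi> z) = \<psi> (\<lambda>n. list_eval (map (\<lambda>F. F n) ?G) (z n))"
    by (rule psi_list_eval[OF G zT])
  also have "\<dots> = \<zero>\<^bsub>A\<^esub>" using z(1) psi_zero by simp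
  finally have root: "A.eval (map \<psi> ?G) (\<psi> z) = \<zero>\<^bsub>A\<^esub>" .
  have Gs: "set (map \<psi> ?G) \<subseteq> carrier A" using G psi_closed by auto
  have "p = map (\<lambda>a. c \<otimes>\<^bsub>A\<^esub> a) (map \<psi> ?G)"
  proof -
    have "map (\<lambda>a. c \<otimes>\<^bsub>A\<^esub> a) (map (\<lambda>a. inv\<^bsub>A\<^esub> c \<otimes>\<^bsub>A\<^esub> a) cs) = cs"
      using c(1,3) ic by (auto intro!: map_idI simp: A.m_assoc[symmetric] subset_iff)
    thus ?thesis using c(1) Fs(2) psi_one by (simp add: pc)
  qed
  hence "A.eval p (\<psi> z) = c \<otimes>\<^bsub>A\<^esub> A.eval (map \<psi> ?G) (\<psi> z)"
    using A.eval_smult[OF c(1) Gs zA] by simp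
  hence "A.eval p (\<psi> z) = \<zero>\<^bsub>A\<^esub>" using root c(1) by simp
  thus "\<exists>x\<in>carrier A. A.eval p x = \<zero>\<^bsub>A\<^esub>" using zA by blast
qed

end

end

lemma complex_algebraically_closed: "algebraically_closed (ring_of_type_algebra :: complex ring)"
proof -
  let ?C = "ring_of_type_algebra :: complex ring"
  interpret C: field ?C by (rule field_from_type_algebra)
  have pow: "x [^]\<^bsub>?C\<^esub> (k :: nat) = x ^ k" for x k
    by (induction k) (simp_all add: ring_of_type_algebra_def mult.commute)
  have eval: "C.eval p x = list_eval p x" for p x
    by (induction p) (simp_all add: pow, simp_all add: ring_of_type_algebra_def)
  show ?thesis
  proof (rule C.algebraically_closedI)
    fix p :: "complex list" assume p: "p \<in> carrier (poly_ring ?C)" "length p - 1 > 1"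
    then obtain c cs where pc: "p = c # cs" by (cases p) auto
    have cs: "cs \<noteq> []" using p(2) by (auto simp: pc)
    have "c \<noteq> 0" using p(1) by (simp add: pc univ_poly_def polynomial_def ring_of_type_algebra_def)
    then obtain x where "list_eval p x = 0" using list_eval_has_root[of c cs] pc cs by blast
    thus "\<exists>x\<in>carrier ?C. C.eval p x = \<zero>\<^bsub>?C\<^esub>"
      by (intro bexI[of _ x]) (simp_all add: eval, simp_all add: ring_of_type_algebra_def)
  qed
qed

lemma (in solid_quotient) complex_iso_adjoin_i:
  "(ring_of_type_algebra :: complex ring) \<simeq> adjoin_i R"
proof -
  let ?C = "ring_of_type_algebra :: complex ring"
  obtain \<psi> where psi: "complexification (adjoin_i R) \<psi>" using adjoin_i_complexification by blast
  have "[n] \<cdot>\<^bsub>?C\<^esub> \<one>\<^bsub>?C\<^esub> = of_nat n" for n :: nat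
    by (induction n) (simp_all add: add_pow_def ring_of_type_algebra_def nat_pow_def add.commute)
  hence "[n] \<cdot>\<^bsub>?C\<^esub> \<one>\<^bsub>?C\<^esub> = \<zero>\<^bsub>?C\<^esub> \<longleftrightarrow> n = 0" for n :: nat
    by (simp add: ring_of_type_algebra_def)
  moreover have "carrier ?C = UNIV" by (simp add: ring_of_type_algebra_def)
  ultimately show ?thesis
    using steinitz[OF complex_algebraically_closed complexification_algebraically_closed[OF psi]]
      complexification_char_zero[OF psi] complexification_eqpoll[OF psi] uncountable_UNIV_complex
    by simp
qed

section \<open>The ultrapower and the asymptotic numbers as quotients of sequence rings\<close>

locale free_ultra =
  fixes U :: "nat filter"
  assumes ultra: "free_ultrafilter U"
begin

lemma eventually_or: "eventually P U \<or> eventually (\<lambda>n. \<not> P n) U"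
  using ultra by (auto simp: free_ultrafilter_def)

lemma not_eventually: "\<not> eventually P U \<longleftrightarrow> eventually (\<lambda>n. \<not> P n) U"
proof
  assume "eventually (\<lambda>n. \<not> P n) U"
  show "\<not> eventually P U"
  proof
    assume "eventually P U"
    with \<open>eventually (\<lambda>n. \<not> P n) U\<close> have "eventually (\<lambda>n. False) U"
      by eventually_elim simp
    thus False using ultra by (simp add: free_ultrafilter_def eventually_False)
  qed
qed (use eventually_or in blast)

lemma star_class_mem: "b \<in> star_class U a \<longleftrightarrow> eventually (\<lambda>n. a n = b n) U"
  by (simp add: star_class_def star_rel_def)

lemma star_class_nonempty: "star_class U a \<noteq> {}"
proof -
  have "a \<in> star_class U a" by (simp add: star_class_mem)
  thus ?thesis by blast
qed

lemma star_class_eq_iff: "star_class U a = star_class U b \<longleftrightarrow> eventually (\<lambda>n. a n = b n) U"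
proof
  assume "star_class U a = star_class U b"
  moreover have "b \<in> star_class U b" by (simp add: star_class_mem)
  ultimately show "eventually (\<lambda>n. a n = b n) U" by (simp flip: star_class_mem)
next
  assume ab: "eventually (\<lambda>n. a n = b n) U"
  have "eventually (\<lambda>n. a n = c n) U \<longleftrightarrow> eventually (\<lambda>n. b n = c n) U" for c
  proof
    assume "eventually (\<lambda>n. a n = c n) U"
    with ab show "eventually (\<lambda>n. b n = c n) U" by eventually_elim simp
  next
    assume "eventually (\<lambda>n. b n = c n) U"
    with ab show "eventually (\<lambda>n. a n = c n) U" by eventually_elim simp
  qed
  thus "star_class U a = star_class U b" by (auto simp: star_class_mem)
qed

lemma star_carrier: "carrier (star_R U) = range (star_class U)"
  by (auto simp: star_R_def quotient_def star_class_def)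

lemma star_class_in_carrier [simp]: "star_class U a \<in> carrier (star_R U)"
  by (simp add: star_carrier)

lemma star_mult: "star_class U a \<otimes>\<^bsub>star_R U\<^esub> star_class U b = star_class U (\<lambda>n. a n * b n)"
proof -
  have "star_class U (\<lambda>n. a' n * b' n) = star_class U (\<lambda>n. a n * b n)"
    if "a' \<in> star_class U a" "b' \<in> star_class U b" for a' b'
    using that unfolding star_class_mem star_class_eq_iff by eventually_elim simp
  thus ?thesis
    by (simp add: star_R_def SUP_eq_const star_class_nonempty)
qed

lemma star_add: "star_class U a \<oplus>\<^bsub>star_R U\<^esub> star_class U b = star_class U (\<lambda>n. a n + b n)"
proof -
  have "star_class U (\<lambda>n. a' n + b' n) = star_class U (\<lambda>n. a n + b n)"
    if "a' \<in> star_class U a" "b' \<in> star_class U b" for a' b'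
    using that unfolding star_class_mem star_class_eq_iff by eventually_elim simp
  thus ?thesis
    by (simp add: star_R_def SUP_eq_const star_class_nonempty)
qed

lemma star_one: "\<one>\<^bsub>star_R U\<^esub> = star_class U (\<lambda>_. 1)"
  and star_zero: "\<zero>\<^bsub>star_R U\<^esub> = star_class U (\<lambda>_. 0)"
  by (simp_all add: star_R_def star_of_def)

lemma star_cring: "cring (star_R U)"
proof (rule cringI)
  show "abelian_group (star_R U)"
  proof (rule abelian_groupI)
    fix x assume "x \<in> carrier (star_R U)"
    then obtain a where "x = star_class U a" by (auto simp: star_carrier)
    thus "\<exists>y\<in>carrier (star_R U). y \<oplus>\<^bsub>star_R U\<^esub> x = \<zero>\<^bsub>star_R U\<^esub>"
      by (intro bexI[of _ "star_class U (\<lambda>n. - a n)"]) (simp_all add: star_add star_zero)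
  qed (auto simp: star_carrier star_add star_zero algebra_simps)
  show "comm_monoid (star_R U)"
    by (rule comm_monoidI) (auto simp: star_carrier star_mult star_one algebra_simps)
qed (auto simp: star_carrier star_add star_mult algebra_simps)

lemma star_field: "field (star_R U)"
proof (rule cring.cring_fieldI2[OF star_cring])
  have "\<not> eventually (\<lambda>n. (0::real) = 1) U" by (simp add: not_eventually)
  thus "\<zero>\<^bsub>star_R U\<^esub> \<noteq> \<one>\<^bsub>star_R U\<^esub>" by (simp add: star_zero star_one star_class_eq_iff)
  fix x assume "x \<in> carrier (star_R U)" "x \<noteq> \<zero>\<^bsub>star_R U\<^esub>"
  then obtain a where a: "x = star_class U a" and "star_class U a \<noteq> star_class U (\<lambda>_. 0)"
    by (auto simp: star_carrier star_zero)
  from this(2) have "eventually (\<lambda>n. a n \<noteq> 0) U"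
    by (simp add: star_class_eq_iff not_eventually)
  hence "eventually (\<lambda>n. a n * inverse (a n) = 1) U" by eventually_elim simp
  hence "x \<otimes>\<^bsub>star_R U\<^esub> star_class U (\<lambda>n. inverse (a n)) = \<one>\<^bsub>star_R U\<^esub>"
    by (simp add: a star_mult star_one star_class_eq_iff)
  thus "\<exists>y\<in>carrier (star_R U). x \<otimes>\<^bsub>star_R U\<^esub> y = \<one>\<^bsub>star_R U\<^esub>" by (rule bexI) simp
qed

sublocale star: field "star_R U"
  by (rule star_field)

lemma star_uminus: "\<ominus>\<^bsub>star_R U\<^esub> star_class U a = star_class U (\<lambda>n. - a n)"
  by (rule star.minus_equality) (simp_all add: star_add star_zero)

lemma star_inv:
  assumes "eventually (\<lambda>n. a n \<noteq> 0) U"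
  shows "inv\<^bsub>star_R U\<^esub> star_class U a = star_class U (\<lambda>n. inverse (a n))"
proof (rule star.comm_inv_char)
  from assms have "eventually (\<lambda>n. a n * inverse (a n) = 1) U" by eventually_elim simp
  thus "star_class U a \<otimes>\<^bsub>star_R U\<^esub> star_class U (\<lambda>n. inverse (a n)) = \<one>\<^bsub>star_R U\<^esub>"
    by (simp add: star_mult star_one star_class_eq_iff)
qed simp_all

lemma star_power: "star_class U a [^]\<^bsub>star_R U\<^esub> (k::nat) = star_class U (\<lambda>n. a n ^ k)"
  by (induction k) (simp_all add: star_one star_mult mult.commute)

lemma star_le_iff: "star_le U (star_class U a) (star_class U b) \<longleftrightarrow> eventually (\<lambda>n. a n \<le> b n) U"
proof
  assume "star_le U (star_class U a) (star_class U b)"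
  then obtain a' b' where "eventually (\<lambda>n. a n = a' n) U" "eventually (\<lambda>n. b n = b' n) U"
    "eventually (\<lambda>n. a' n \<le> b' n) U"
    by (auto simp: star_le_def star_class_mem)
  thus "eventually (\<lambda>n. a n \<le> b n) U" by eventually_elim simp
next
  assume "eventually (\<lambda>n. a n \<le> b n) U"
  moreover have "a \<in> star_class U a" "b \<in> star_class U b" by (simp_all add: star_class_mem)
  ultimately show "star_le U (star_class U a) (star_class U b)" unfolding star_le_def by blast
qed

lemma star_less_iff: "star_less U (star_class U a) (star_class U b) \<longleftrightarrow> eventually (\<lambda>n. a n < b n) U"
proof -
  have "eventually (\<lambda>n. a n < b n) U \<longleftrightarrow> eventually (\<lambda>n. a n \<le> b n \<and> a n \<noteq> b n) U"
    by (simp only: order.strict_iff_order)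
  thus ?thesis
    by (simp add: star_less_def star_le_iff star_class_eq_iff not_eventually eventually_conj_iff)
qed

lemma star_abs_class: "star_abs U (star_class U a) = star_class U (\<lambda>n. \<bar>a n\<bar>)"
proof (cases "eventually (\<lambda>n. 0 \<le> a n) U")
  case True
  hence "eventually (\<lambda>n. a n = \<bar>a n\<bar>) U" by eventually_elim simp
  thus ?thesis using True by (simp add: star_abs_def star_zero star_le_iff star_class_eq_iff)
next
  case False
  hence "eventually (\<lambda>n. \<not> 0 \<le> a n) U" by (simp add: not_eventually)
  hence "eventually (\<lambda>n. - a n = \<bar>a n\<bar>) U" by eventually_elim simp
  thus ?thesis using False by (simp add: star_abs_def star_zero star_le_iff star_uminus star_class_eq_iff)
qed

lemma star_solid_quotient: "solid_quotient (star_R U) UNIV (star_class U)"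
  by unfold_locales (simp_all add: star_carrier star_add star_mult star_one)

end

text \<open>
  The sequence \<open>r\<close> represents the infinitesimal that determines the field of asymptotic numbers.
\<close>

locale asymptotic = free_ultra +
  fixes r :: "nat \<Rightarrow> real"
  assumes r_pos: "eventually (\<lambda>k. 0 < r k) U"
    and r_small: "\<And>m::nat. m \<ge> 1 \<Longrightarrow> eventually (\<lambda>k. r k < 1 / real m) U"
begin

abbreviation \<rho> where "\<rho> \<equiv> star_class U r"

definition mod_seqs :: "(nat \<Rightarrow> real) set" where
  "mod_seqs = {a. \<exists>n\<ge>1. eventually (\<lambda>k. \<bar>a k\<bar> \<le> inverse (r k ^ n)) U}"

definition null_seqs :: "(nat \<Rightarrow> real) set" where
  "null_seqs = {a. \<forall>n\<ge>1. eventually (\<lambda>k. \<bar>a k\<bar> < r k ^ n) U}"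

lemma r_half: "eventually (\<lambda>k. 0 < r k \<and> r k < 1 / 2) U"
  using r_pos r_small[of 2, simplified] by eventually_elim simp

lemma moderate_iff: "star_class U a \<in> moderate U \<rho> \<longleftrightarrow> a \<in> mod_seqs"
proof -
  have "eventually (\<lambda>k. r k ^ n \<noteq> 0) U" for n using r_pos by eventually_elim simp
  thus ?thesis
    by (simp add: moderate_def mod_seqs_def star_power star_inv star_abs_class star_le_iff)
qed

lemma negligible_iff: "star_class U a \<in> negligible U \<rho> \<longleftrightarrow> a \<in> null_seqs"
  by (simp add: negligible_def null_seqs_def star_power star_abs_class star_less_iff)

lemma moderate_eq: "moderate U \<rho> = star_class U ` mod_seqs"
proof -
  have "moderate U \<rho> \<subseteq> range (star_class U)" by (auto simp: moderate_def star_carrier)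
  thus ?thesis using moderate_iff by blast
qed

lemma negligible_eq: "negligible U \<rho> = star_class U ` null_seqs"
proof -
  have "negligible U \<rho> \<subseteq> range (star_class U)" by (auto simp: negligible_def star_carrier)
  thus ?thesis using negligible_iff by blast
qed

lemma mod_seqs_solid:
  assumes "f \<in> mod_seqs" "\<And>n. \<bar>g n\<bar> \<le> \<bar>f n\<bar>" shows "g \<in> mod_seqs"
  using assms(1) unfolding mod_seqs_def
  by (auto elim!: eventually_mono intro: order.trans[OF assms(2)])

lemma inverse_power_le:
  assumes "0 < x" "x < 1/2" "m \<le> n" shows "inverse (x ^ m) \<le> inverse (x ^ n :: real)"
  using assms by (intro le_imp_inverse_le power_decreasing) auto

lemma mod_seqs_const: "(\<lambda>_. c) \<in> mod_seqs"
proof -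
  obtain m :: nat where m: "m \<ge> 1" "\<bar>c\<bar> \<le> real m"
    by (metis real_arch_simple le_cases max.cobounded1 max.cobounded2 of_nat_le_iff order.trans)
  have "eventually (\<lambda>k. \<bar>c\<bar> \<le> inverse (r k ^ 1)) U"
    using r_pos r_small[OF m(1)]
  proof eventually_elim
    case (elim k)
    hence "real m \<le> inverse (r k)" using m(1) by (simp add: field_simps)
    thus ?case using m(2) by simp
  qed
  thus ?thesis unfolding mod_seqs_def by blast
qed

text \<open>
  One additional factor \<open>1 / r k > 2\<close> absorbs the sum of the two bounds.
\<close>

lemma mod_seqs_add:
  assumes "f \<in> mod_seqs" "g \<in> mod_seqs" shows "(\<lambda>n. f n + g n) \<in> mod_seqs"
proof -
  obtain m n where mn: "eventually (\<lambda>k. \<bar>f k\<bar> \<le> inverse (r k ^ m)) U" "eventually (\<lambda>k. \<bar>g k\<bar> \<le> inverse (r k ^ n)) U"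
    using assms by (auto simp: mod_seqs_def)
  have "eventually (\<lambda>k. \<bar>f k + g k\<bar> \<le> inverse (r k ^ Suc (max m n))) U"
    using mn r_half
  proof eventually_elim
    case (elim k)
    have "\<bar>f k + g k\<bar> \<le> inverse (r k ^ m) + inverse (r k ^ n)" using elim by linarith
    also have "\<dots> \<le> inverse (r k ^ max m n) + inverse (r k ^ max m n)"
      using elim by (intro add_mono inverse_power_le) auto
    also have "\<dots> = 2 * inverse (r k ^ max m n)" by simp
    also have "\<dots> \<le> inverse (r k) * inverse (r k ^ max m n)"
      using elim by (intro mult_right_mono) (auto simp: field_simps)
    finally show ?case by simp
  qed
  thus ?thesis unfolding mod_seqs_def by (auto intro!: exI[of _ "Suc (max m n)"])
qed

lemma mod_seqs_mult:
  assumes "f \<in> mod_seqs" "g \<in> mod_seqs" shows "(\<lambda>n. f n * g n) \<in> mod_seqs"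
proof -
  obtain m n where mn: "m \<ge> 1" "eventually (\<lambda>k. \<bar>f k\<bar> \<le> inverse (r k ^ m)) U" "eventually (\<lambda>k. \<bar>g k\<bar> \<le> inverse (r k ^ n)) U"
    using assms by (auto simp: mod_seqs_def)
  have "eventually (\<lambda>k. \<bar>f k * g k\<bar> \<le> inverse (r k ^ (m + n))) U"
    using mn(2,3) r_half
  proof eventually_elim
    case (elim k)
    have "\<bar>f k * g k\<bar> \<le> inverse (r k ^ m) * inverse (r k ^ n)"
      unfolding abs_mult using elim by (intro mult_mono) auto
    thus ?case by (simp add: power_add)
  qed
  thus ?thesis unfolding mod_seqs_def using mn(1) by (auto intro!: exI[of _ "m + n"])
qed

lemma mod_seqs_uminus: "f \<in> mod_seqs \<Longrightarrow> (\<lambda>n. - f n) \<in> mod_seqs"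
  by (erule mod_seqs_solid) simp

lemma null_seqs_add:
  assumes "f \<in> null_seqs" "g \<in> null_seqs" shows "(\<lambda>n. f n + g n) \<in> null_seqs"
proof -
  have "eventually (\<lambda>k. \<bar>f k + g k\<bar> < r k ^ n) U" if "n \<ge> 1" for n
  proof -
    have "eventually (\<lambda>k. \<bar>f k\<bar> < r k ^ Suc n) U" "eventually (\<lambda>k. \<bar>g k\<bar> < r k ^ Suc n) U"
      using assms by (auto simp: null_seqs_def simp del: power_Suc)
    thus ?thesis using r_half
    proof eventually_elim
      case (elim k)
      have "\<bar>f k + g k\<bar> < 2 * r k * r k ^ n" using elim by simp
      also have "\<dots> \<le> 1 * r k ^ n" using elim by (intro mult_right_mono) auto
      finally show ?case by simp
    qed
  qed
  thus ?thesis by (auto simp: null_seqs_def)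
qed

lemma null_seqs_mult:
  assumes "f \<in> null_seqs" "g \<in> mod_seqs" shows "(\<lambda>n. f n * g n) \<in> null_seqs"
proof -
  obtain m where m: "eventually (\<lambda>k. \<bar>g k\<bar> \<le> inverse (r k ^ m)) U"
    using assms by (auto simp: mod_seqs_def)
  have "eventually (\<lambda>k. \<bar>f k * g k\<bar> < r k ^ n) U" if "n \<ge> 1" for n
  proof -
    have "eventually (\<lambda>k. \<bar>f k\<bar> < r k ^ (n + m)) U"
      using assms(1) that by (auto simp: null_seqs_def)
    thus ?thesis using m r_half
    proof eventually_elim
      case (elim k)
      have "\<bar>f k * g k\<bar> \<le> \<bar>f k\<bar> * inverse (r k ^ m)"
        unfolding abs_mult using elim by (intro mult_left_mono) auto
      also have "\<dots> < r k ^ (n + m) * inverse (r k ^ m)"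
        using elim by (intro mult_strict_right_mono) auto
      also have "\<dots> = r k ^ n" using elim by (simp add: power_add)
      finally show ?case .
    qed
  qed
  thus ?thesis by (auto simp: null_seqs_def)
qed

lemma null_seqs_subset: "null_seqs \<subseteq> mod_seqs"
proof
  fix f assume "f \<in> null_seqs"
  hence "eventually (\<lambda>k. \<bar>f k\<bar> < r k ^ 1) U" by (auto simp only: null_seqs_def mem_Collect_eq)
  hence "eventually (\<lambda>k. \<bar>f k\<bar> \<le> inverse (r k ^ 1)) U"
    using r_half
  proof eventually_elim
    case (elim k)
    have "r k \<le> 1" "1 \<le> inverse (r k)" using elim by (auto simp: field_simps)
    thus ?case using elim by simp
  qed
  thus "f \<in> mod_seqs" unfolding mod_seqs_def by blast
qed

abbreviation M where "M \<equiv> (star_R U)\<lparr>carrier := moderate U \<rho>\<rparr>"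

lemma M_domain: "domain M"
proof (rule star.subring_is_domain, rule star.subringI)
  show "moderate U \<rho> \<subseteq> carrier (star_R U)" by (auto simp: moderate_def)
qed (auto simp: moderate_eq star_one star_uminus star_mult star_add
    intro!: imageI mod_seqs_const mod_seqs_add mod_seqs_mult mod_seqs_uminus)

sublocale M: domain M
  by (rule M_domain)

lemma zero_null_seqs: "(\<lambda>_. 0) \<in> null_seqs"
  using r_pos by (auto simp: null_seqs_def elim!: eventually_mono)

lemma negligible_ideal: "ideal (negligible U \<rho>) M"
proof (rule idealI[OF M.ring_axioms])
  show "subgroup (negligible U \<rho>) (add_monoid M)"
  proof (rule M.add.subgroupI)
    show "negligible U \<rho> \<subseteq> carrier M"
      using null_seqs_subset by (auto simp: negligible_eq moderate_eq)
    show "negligible U \<rho> \<noteq> {}" using zero_null_seqs by (auto simp: negligible_eq)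
    fix x assume "x \<in> negligible U \<rho>"
    then obtain a where a: "x = star_class U a" "a \<in> null_seqs" by (auto simp: negligible_eq)
    have a': "(\<lambda>n. - a n) \<in> null_seqs" using a(2) by (simp add: null_seqs_def)
    have "\<ominus>\<^bsub>M\<^esub> x = star_class U (\<lambda>n. - a n)"
      using a a' null_seqs_subset
      by (intro M.minus_equality) (auto simp: star_add star_zero moderate_eq)
    thus "\<ominus>\<^bsub>M\<^esub> x \<in> negligible U \<rho>" using a' by (simp add: negligible_eq)
    fix y assume "y \<in> negligible U \<rho>"
    then obtain b where "y = star_class U b" "b \<in> null_seqs" by (auto simp: negligible_eq)
    thus "x \<oplus>\<^bsub>M\<^esub> y \<in> negligible U \<rho>" using a null_seqs_add by (auto simp: negligible_eq star_add)
  qed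
next
  fix a x assume "a \<in> negligible U \<rho>" "x \<in> carrier M"
  then obtain f g where fg: "a = star_class U f" "f \<in> null_seqs" "x = star_class U g" "g \<in> mod_seqs"
    by (auto simp: negligible_eq moderate_eq)
  show "a \<otimes>\<^bsub>M\<^esub> x \<in> negligible U \<rho>"
    using null_seqs_mult[OF fg(2,4)] by (simp add: fg star_mult negligible_iff)
  show "x \<otimes>\<^bsub>M\<^esub> a \<in> negligible U \<rho>"
    using null_seqs_mult[OF fg(2,4)] by (simp add: fg star_mult negligible_iff mult.commute)
qed

sublocale I: ideal "negligible U \<rho>" M
  by (rule negligible_ideal)

definition rho_class :: "(nat \<Rightarrow> real) \<Rightarrow> star_real set" where
  "rho_class f = negligible U \<rho> +>\<^bsub>M\<^esub> star_class U f"

lemma rho_R_eq: "rho_R U \<rho> = M Quot (negligible U \<rho>)"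
  by (simp add: rho_R_def)

lemma rho_class_hom:
  assumes "f \<in> mod_seqs" "g \<in> mod_seqs"
  shows "rho_class (\<lambda>n. f n + g n) = rho_class f \<oplus>\<^bsub>rho_R U \<rho>\<^esub> rho_class g"
    and "rho_class (\<lambda>n. f n * g n) = rho_class f \<otimes>\<^bsub>rho_R U \<rho>\<^esub> rho_class g"
proof -
  have C: "star_class U f \<in> carrier M" "star_class U g \<in> carrier M" using assms by (simp_all add: moderate_iff)
  show "rho_class (\<lambda>n. f n + g n) = rho_class f \<oplus>\<^bsub>rho_R U \<rho>\<^esub> rho_class g"
    using ring_hom_add[OF I.rcos_ring_hom C] by (simp add: rho_class_def rho_R_eq star_add)
  show "rho_class (\<lambda>n. f n * g n) = rho_class f \<otimes>\<^bsub>rho_R U \<rho>\<^esub> rho_class g"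
    using ring_hom_mult[OF I.rcos_ring_hom C] by (simp add: rho_class_def rho_R_eq star_mult)
qed

lemma rho_class_one: "rho_class (\<lambda>_. 1) = \<one>\<^bsub>rho_R U \<rho>\<^esub>"
  using ring_hom_one[OF I.rcos_ring_hom] by (simp add: rho_class_def rho_R_eq star_one)

lemma rho_carrier: "rho_class ` mod_seqs = carrier (rho_R U \<rho>)"
  by (auto simp: rho_R_eq FactRing_def A_RCOSETS_def' rho_class_def moderate_eq)

lemma rho_class_eq_zero_iff:
  assumes "f \<in> mod_seqs"
  shows "rho_class f = \<zero>\<^bsub>rho_R U \<rho>\<^esub> \<longleftrightarrow> f \<in> null_seqs"
proof -
  have C: "star_class U f \<in> carrier M" using assms by (simp add: moderate_iff)
  have "rho_class f = \<zero>\<^bsub>rho_R U \<rho>\<^esub> \<longleftrightarrow> negligible U \<rho> +>\<^bsub>M\<^esub> star_class U f = negligible U \<rho>"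
    by (simp add: rho_class_def rho_R_eq FactRing_def)
  also have "\<dots> \<longleftrightarrow> star_class U f \<in> negligible U \<rho>"
    using I.a_rcos_self[OF C] I.a_rcos_const by auto
  finally show ?thesis by (simp add: negligible_iff)
qed

text \<open>
  A sequence that is not negligible is bounded below by some \<open>r k ^ n\<close> on a set of the ultrafilter,
  by the ultrafilter property, and so its termwise inverse is moderate.
\<close>

lemma rho_field: "field (rho_R U \<rho>)"
proof -
  interpret Q: cring "rho_R U \<rho>"
    unfolding rho_R_eq by (rule I.quotient_is_cring[OF M.cring_axioms])
  show ?thesis
  proof (rule Q.cring_fieldI2)
    have "(\<lambda>_. 1) \<notin> null_seqs"
    proof
      assume "(\<lambda>_. 1) \<in> null_seqs"
      hence "eventually (\<lambda>k. \<bar>1\<bar> < r k ^ 1) U" by (auto simp only: null_seqs_def mem_Collect_eq)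
      hence "eventually (\<lambda>k. False) U" using r_half by eventually_elim simp
      thus False using not_eventually[of "\<lambda>_. False"] by simp
    qed
    hence "rho_class (\<lambda>_. 1) \<noteq> \<zero>\<^bsub>rho_R U \<rho>\<^esub>"
      using rho_class_eq_zero_iff[OF mod_seqs_const[of 1]] by simp
    thus "\<zero>\<^bsub>rho_R U \<rho>\<^esub> \<noteq> \<one>\<^bsub>rho_R U \<rho>\<^esub>" by (metis rho_class_one)
    fix x assume "x \<in> carrier (rho_R U \<rho>)" "x \<noteq> \<zero>\<^bsub>rho_R U \<rho>\<^esub>"
    then obtain f where f: "x = rho_class f" "f \<in> mod_seqs" "f \<notin> null_seqs"
      using rho_class_eq_zero_iff by (auto simp: rho_carrier[symmetric])
    then obtain n where n: "n \<ge> 1" "eventually (\<lambda>k. \<not> \<bar>f k\<bar> < r k ^ n) U"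
      by (auto simp: null_seqs_def not_eventually)
    have "eventually (\<lambda>k. \<bar>inverse (f k)\<bar> \<le> inverse (r k ^ n)) U"
      using n(2) r_pos by eventually_elim (simp add: abs_inverse le_imp_inverse_le)
    hence g: "(\<lambda>k. inverse (f k)) \<in> mod_seqs" using n(1) by (auto simp: mod_seqs_def)
    have "eventually (\<lambda>k. f k * inverse (f k) = 1) U"
      using n(2) r_pos
    proof eventually_elim
      case (elim k)
      hence "f k \<noteq> 0" by auto
      thus ?case by simp
    qed
    hence "star_class U (\<lambda>k. f k * inverse (f k)) = star_class U (\<lambda>_. 1)"
      by (simp add: star_class_eq_iff)
    hence "rho_class (\<lambda>k. f k * inverse (f k)) = rho_class (\<lambda>_. 1)" by (simp add: rho_class_def)
    hence "x \<otimes>\<^bsub>rho_R U \<rho>\<^esub> rho_class (\<lambda>k. inverse (f k)) = \<one>\<^bsub>rho_R U \<rho>\<^esub>"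
      using rho_class_hom(2)[OF f(2) g] by (simp add: f(1) rho_class_one)
    moreover have "rho_class (\<lambda>k. inverse (f k)) \<in> carrier (rho_R U \<rho>)"
      using g rho_carrier by blast
    ultimately show "\<exists>y\<in>carrier (rho_R U \<rho>). x \<otimes>\<^bsub>rho_R U \<rho>\<^esub> y = \<one>\<^bsub>rho_R U \<rho>\<^esub>" by blast
  qed
qed

lemma rho_solid_quotient: "solid_quotient (rho_R U \<rho>) mod_seqs rho_class"
  by (intro solid_quotient.intro solid_quotient_axioms.intro)
    (fact rho_field mod_seqs_const mod_seqs_add mod_seqs_mult mod_seqs_solid rho_carrier
      rho_class_hom rho_class_one)+

end

theorem mainTheorem4:
  fixes U :: "nat filter" and \<rho> :: star_real
  assumes "free_ultrafilter U"
    and "\<rho> \<in> carrier (star_R U)"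
    and "star_less U \<zero>\<^bsub>star_R U\<^esub> \<rho>"
    and "star_infinitesimal U \<rho>"
  shows "(ring_of_type_algebra :: complex ring) \<simeq> star_C U \<and> star_C U \<simeq> rho_C U \<rho>"
proof -
  interpret free_ultra U by (rule free_ultra.intro) fact
  obtain r where r: "\<rho> = star_class U r" using assms(2) by (auto simp: star_carrier)
  have pos: "eventually (\<lambda>k. 0 < r k) U"
    using assms(3) by (simp add: r star_zero star_less_iff)
  have small: "eventually (\<lambda>k. r k < 1 / real m) U" if "m \<ge> 1" for m
  proof -
    have "eventually (\<lambda>k. \<bar>r k\<bar> < 1 / real m) U"
      using assms(4) that by (simp add: star_infinitesimal_def r star_abs_class star_of_def star_less_iff)
    thus ?thesis by eventually_elim simp
  qed
  interpret asymptotic U r using pos small by unfold_locales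
  let ?C = "ring_of_type_algebra :: complex ring"
  have star: "?C \<simeq> star_C U"
    unfolding star_C_def by (rule solid_quotient.complex_iso_adjoin_i[OF star_solid_quotient])
  have rho: "?C \<simeq> rho_C U \<rho>"
    unfolding rho_C_def r by (rule solid_quotient.complex_iso_adjoin_i[OF rho_solid_quotient])
  have "ring ?C" by (rule ring_from_type_algebra)
  hence "star_C U \<simeq> ?C" using star ring_iso_sym by blast
  thus ?thesis using star rho ring_iso_trans by blast
qed

end
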